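(* Let $G$ be a Lie group, $H\subset G$ a Lie subgroup acting on $G$ by left multiplication, and let $\mathscr L_d$ be the discrete covariant Lagrangian density, with associated discrete Lagrangians $\mathsf L_d$, $\mathsf N_d$, discrete covariant momentum maps $J^k_{\mathscr L_d}$, and discrete momentum maps $\mathbf J^\pm_{\mathsf L_d}$, $\mathbf J^\pm_{\mathsf N_d}$ associated to the action of $H$, all as defined in the context. Suppose that $\mathscr L_d$ is $H$-invariant, and let $g_d=\{g_a^j\}_{0\le j\le N,\,0\le a\le A}$ be a discrete field satisfying the discrete covariant Euler-Lagrange equations $$\frac1{\Delta t}\Big(-\mu_a^j+\mathrm{Ad}^*_{\tau(\Delta t\,\xi_a^{j-1})}\mu_a^{j-1}\Big)+\frac1{\Delta s}\Big(\lambda_a^j-\mathrm{Ad}^*_{\tau(\Delta s\,\eta_{a-1}^j)}\lambda_{a-1}^j\Big)-(g_a^j)^{-1}D_{g_a^j}\Pi(g_a^j)=0$$ for all $1\le j\le N-1$, $1\le a\le A-1$. (1) Independently of the imposed boundary conditions, the discrete covariant Noether theorem holds: $\mathscr J_{B,C}^{K,L}(g_d)=0$ for all $0\le B<C\le A-1$ and $0\le K<L\le N-1$. (2) The validity of the discrete Noether theorems for $\mathbf J^\pm_{\mathsf L_d}$ and $\mathbf J^\pm_{\mathsf N_d}$ depends on the boundary conditions. More precisely: (2a) If the configuration is prescribed at the temporal extremities ($j=0$ and $j=N$) and the zero-traction boundary conditions $$\frac1{\Delta t}\Big(-\mu_0^j+\mathrm{Ad}^*_{\tau(\Delta t\,\xi_0^{j-1})}\mu_0^{j-1}\Big)+\frac1{\Delta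 s}\lambda_0^j=(g_0^j)^{-1}D_{g_0^j}\Pi(g_0^j),\qquad \mathrm{Ad}^*_{\tau(\Delta s\,\eta_{A-1}^j)}\lambda_{A-1}^j=0,\qquad j=1,\dots,N-1,$$ are used, then $\mathbf J^+_{\mathsf L_d}=\mathbf J^-_{\mathsf L_d}=:\mathbf J_{\mathsf L_d}$ and this discrete momentum map is conserved, i.e. $\mathbf J_{\mathsf L_d}(\mathbf g^j,\boldsymbol\xi^j)$ is independent of $j\in\{0,\dots,N-1\}$. In general, conservation of $\mathbf J^\pm_{\mathsf N_d}$ (independence of $a$) does not hold in this case. (2b) If the configuration is prescribed at the spatial extremities ($a=0$ and $a=A$) and the zero-momentum boundary conditions $$-\frac1{\Delta t}\mu_a^0+\frac1{\Delta s}\Big(\lambda_a^0-\mathrm{Ad}^*_{\tau(\Delta s\,\eta_{a-1}^0)}\lambda_{a-1}^0\Big)=(g_a^0)^{-1}D_{g_a^0}\Pi(g_a^0),\qquad \mathrm{Ad}^*_{\tau(\Delta t\,\xi_a^{N-1})}\mu_a^{N-1}=0,\qquad a=1,\dots,A-1,$$ are used, then $\mathbf J^+_{\mathsf N_d}=\mathbf J^-_{\mathsf N_d}=:\mathbf J_{\mathsf N_d}$ and this discrete momentum map is conserved, i.e. $\mathbf J_{\mathsf N_d}(\mathbf g_a,\boldsymbol\eta_a)$ is independent of $a\in\{0,\dots,A-1\}$. In general, conservation of $\mathbf J^\pm_{\mathsf L_d}$ (independence of $j$) does not hold in this case.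
   Context: $G$ has Lie algebra $\mathfrak g$ (in the paper's application $G=SE(3)$), $H$ has Lie algebra $\mathfrak h$, and $i^*:\mathfrak g^*\to\mathfrak h^*$ is the dual of the inclusion $i:\mathfrak h\to\mathfrak g$. $\Delta t,\Delta s>0$ are the time and space steps; $\triangle_a^j=((j,a),(j+1,a),(j,a+1))$ for $0\le j\le N-1$, $0\le a\le A-1$. $K,\Phi:\mathfrak g\to\mathbb R$ and $\Pi:G\to\mathbb R$ are smooth (the letter $K$ is also used as a time index), and $\tau:\mathfrak g\to G$ is a smooth map with $\tau(0)=e$ which is a local diffeomorphism around the origin. For a discrete field $g_d$, define $\xi_a^j,\eta_a^j\in\mathfrak g$ by $\tau(\Delta t\,\xi_a^j)=(g_a^j)^{-1}g_a^{j+1}$ and $\tau(\Delta s\,\eta_a^j)=(g_a^j)^{-1}g_{a+1}^j$ (the increments being in the range where $\tau$ is invertible). The discrete Lagrangian density is $\mathscr L_d(\triangle_a^j,g_a^j,\xi_a^j,\eta_a^j)=\Delta t\,\Delta s\,[K(\xi_a^j)-\Phi(\eta_a^j)-\Pi(g_a^j)]$. It is $H$-invariant if $\mathscr L_d(\triangle_a^j,hg,\xi,\eta)=\mathscr L_d(\triangle_a^j,g,\xi,\eta)$ for all $h\in H$ (note $\xi_a^j,\eta_a^j$ are unchanged under $g_a^j\mapsto hg_a^j$). With the right trivialized derivative $\mathrm d\tau_\xi(\eta)=(T_\xi\tau(\eta))\tau(\xi)^{-1}$, set $$\mu_a^j=\big(\mathrm d\tau^{-1}_{\Delta t\,\xi_a^j}\big)^*\partial_\xi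 K(\xi_a^j),\qquad \lambda_a^j=\big(\mathrm d\tau^{-1}_{\Delta s\,\eta_a^j}\big)^*\partial_\eta\Phi(\eta_a^j).$$ $\mathrm{Ad}_g^*$ is the dual of $\mathrm{Ad}_g$, $D_g\Pi(g)\in T_g^*G$ is the differential of $\Pi$ at $g$, and $\langle g^{-1}\alpha,\zeta\rangle=\langle\alpha,g\zeta\rangle$ for $\alpha\in T^*_gG,\zeta\in\mathfrak g$. The discrete covariant momentum maps, with values in $\mathfrak h^*$, evaluated on $g_d$ (abbreviating $J^k_{\mathscr L_d}(\triangle_a^j)=J^k_{\mathscr L_d}(\triangle_a^j,g_a^j,\xi_a^j,\eta_a^j)$) are $$J^1_{\mathscr L_d}(\triangle_a^j)=i^*\mathrm{Ad}^*_{(g_a^j)^{-1}}\big(-\Delta s\,\mu_a^j+\Delta t\,\lambda_a^j-\Delta t\,\Delta s\,(g_a^j)^{-1}D_{g_a^j}\Pi(g_a^j)\big),$$ $$J^2_{\mathscr L_d}(\triangle_a^j)=i^*\mathrm{Ad}^*_{(g_a^{j+1})^{-1}}\big(\Delta s\,\mathrm{Ad}^*_{\tau(\Delta t\,\xi_a^j)}\mu_a^j\big),\qquad J^3_{\mathscr L_d}(\triangle_a^j)=i^*\mathrm{Ad}^*_{(g_{a+1}^j)^{-1}}\big(-\Delta t\,\mathrm{Ad}^*_{\tau(\Delta s\,\eta_a^j)}\lambda_a^j\big).$$ For $0\le B<C\le A-1$ and $0\le K<L\le N-1$, $$\mathscr J_{B,C}^{K,L}(g_d)=\sum_{j=K+1}^{L}\big(J^1_{\mathscr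 L_d}(\triangle_B^j)+J^2_{\mathscr L_d}(\triangle_B^{j-1})+J^3_{\mathscr L_d}(\triangle_C^j)\big)+\sum_{a=B+1}^{C}\big(J^1_{\mathscr L_d}(\triangle_a^K)+J^2_{\mathscr L_d}(\triangle_a^L)+J^3_{\mathscr L_d}(\triangle_{a-1}^K)\big)+J^1_{\mathscr L_d}(\triangle_B^K)+J^2_{\mathscr L_d}(\triangle_B^L)+J^3_{\mathscr L_d}(\triangle_C^K).$$ With $\mathbf g^j=(g_0^j,\dots,g_A^j)$, $\mathbf g_a=(g_a^0,\dots,g_a^N)$, and $\boldsymbol\xi^j,\boldsymbol\eta_a$ the corresponding collections of $\xi_a^j$ (over $a$) and $\eta_a^j$ (over $j$), the time- and space-evolution Lagrangians are $\mathsf L_d(\mathbf g^j,\boldsymbol\xi^j)=\sum_{a=0}^{A-1}\mathscr L_d(\triangle_a^j,g_a^j,\xi_a^j,\eta_a^j)$ and $\mathsf N_d(\mathbf g_a,\boldsymbol\eta_a)=\sum_{j=0}^{N-1}\mathscr L_d(\triangle_a^j,g_a^j,\xi_a^j,\eta_a^j)$, and their discrete momentum maps are $$\mathbf J^-_{\mathsf L_d}(\mathbf g^j,\boldsymbol\xi^j)=-\sum_{a=0}^{A-1}\big(J^1_{\mathscr L_d}(\triangle_a^j)+J^3_{\mathscr L_d}(\triangle_a^j)\big),\qquad \mathbf J^+_{\mathsf L_d}(\mathbf g^j,\boldsymbol\xi^j)=\sum_{a=0}^{A-1}J^2_{\mathscr L_d}(\triangle_a^j),$$ $$\mathbf J^-_{\mathsf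 N_d}(\mathbf g_a,\boldsymbol\eta_a)=-\sum_{j=0}^{N-1}\big(J^1_{\mathscr L_d}(\triangle_a^j)+J^2_{\mathscr L_d}(\triangle_a^j)\big),\qquad \mathbf J^+_{\mathsf N_d}(\mathbf g_a,\boldsymbol\eta_a)=\sum_{j=0}^{N-1}J^3_{\mathscr L_d}(\triangle_a^j).$$ "In general, conservation does not hold" means that the stated hypotheses of that item do not imply conservation. "The configuration is prescribed" at certain indices means that the values of $g_a^j$ there are fixed, so no equation is imposed at those indices. *)

theory Defs
  imports "HOL-Analysis.Analysis" "HOL-Algebra.Group"
begin

section \<open>Smooth manifolds\<close>

text \<open>Iterated directional derivatives: on an open subset of a finite-dimensional space this is
  the usual notion of a \<open>C\<^sup>k\<close> map.\<close>

primrec Ck_on :: "nat \<Rightarrow> 'a::real_normed_vector set \<Rightarrow> ('a \<Rightarrow> 'b::real_normed_vector) \<Rightarrow> bool" where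
  "Ck_on 0 S f \<longleftrightarrow> continuous_on S f"
| "Ck_on (Suc k) S f \<longleftrightarrow>
     (\<forall>x\<in>S. f differentiable (at x)) \<and> (\<forall>v. Ck_on k S (\<lambda>x. frechet_derivative f (at x) v))"

definition smooth_on :: "'a::real_normed_vector set \<Rightarrow> ('a \<Rightarrow> 'b::real_normed_vector) \<Rightarrow> bool" where
  "smooth_on S f \<longleftrightarrow> (\<forall>k. Ck_on k S f)"

text \<open>A chart is a pair of its domain and its coordinate map. The model space is a
  finite-dimensional type of class \<open>real_normed_vector\<close> and not of class \<open>euclidean_space\<close>,
  because the latter has positive dimension and would exclude discrete (sub)groups.
  The atlas need not be maximal.\<close>

record ('a, 'e) manifold =
  mtop :: "'a topology"
  atlas :: "('a set \<times> ('a \<Rightarrow> 'e)) set"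

definition chart_on :: "'a topology \<Rightarrow> 'a set \<Rightarrow> ('a \<Rightarrow> 'e::real_normed_vector) \<Rightarrow> bool" where
  "chart_on X U \<phi> \<longleftrightarrow> openin X U \<and> open (\<phi> ` U) \<and>
     homeomorphic_map (subtopology X U) (top_of_set (\<phi> ` U)) \<phi>"

definition smooth_manifold :: "('a, 'e::real_normed_vector) manifold \<Rightarrow> bool" where
  "smooth_manifold M \<longleftrightarrow>
     (\<exists>B :: 'e set. finite B \<and> span B = UNIV) \<and>
     Hausdorff_space (mtop M) \<and> second_countable (mtop M) \<and>
     (\<forall>(U, \<phi>) \<in> atlas M. chart_on (mtop M) U \<phi>) \<and>
     \<Union> (fst ` atlas M) = topspace (mtop M) \<and>
     (\<forall>(U, \<phi>) \<in> atlas M. \<forall>(V, \<psi>) \<in> atlas M. smooth_on (\<phi> ` (U \<inter> V)) (\<psi> \<circ> inv_into U \<phi>))"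

definition smooth_map ::
  "('a, 'e::real_normed_vector) manifold \<Rightarrow> ('b, 'f::real_normed_vector) manifold \<Rightarrow> ('a \<Rightarrow> 'b) \<Rightarrow> bool"
where
  "smooth_map M N f \<longleftrightarrow> continuous_map (mtop M) (mtop N) f \<and>
     (\<forall>(U, \<phi>) \<in> atlas M. \<forall>(V, \<psi>) \<in> atlas N.
        smooth_on (\<phi> ` (U \<inter> f -` V)) (\<psi> \<circ> f \<circ> inv_into U \<phi>))"

definition vec_manifold :: "('e, 'e::real_normed_vector) manifold" where
  "vec_manifold = \<lparr>mtop = euclidean, atlas = {(UNIV, \<lambda>x. x)}\<rparr>"

definition prod_manifold ::
  "('a, 'e::real_normed_vector) manifold \<Rightarrow> ('b, 'f::real_normed_vector) manifold \<Rightarrow>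
   ('a \<times> 'b, 'e \<times> 'f) manifold"
where
  "prod_manifold M N = \<lparr>mtop = prod_topology (mtop M) (mtop N),
     atlas = {(U \<times> V, map_prod \<phi> \<psi>) | U \<phi> V \<psi>. (U, \<phi>) \<in> atlas M \<and> (V, \<psi>) \<in> atlas N}\<rparr>"

definition open_submanifold ::
  "('a, 'e::real_normed_vector) manifold \<Rightarrow> 'a set \<Rightarrow> ('a, 'e) manifold"
where
  "open_submanifold M W = \<lparr>mtop = subtopology (mtop M) W,
     atlas = {(U \<inter> W, \<phi>) | U \<phi>. (U, \<phi>) \<in> atlas M}\<rparr>"

text \<open>The tangent space at \<open>p\<close> is represented by the model space, a tangent vector being
  identified with its coordinates in one chart around \<open>p\<close> chosen once and for all. The tangent map
  \<open>T\<^sub>p f\<close> is the derivative of \<open>f\<close> read in the chosen charts around \<open>p\<close> and \<open>f p\<close>.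
  For \<open>vec_manifold\<close> the chosen chart is the identity.\<close>

definition chart_at :: "('a, 'e::real_normed_vector) manifold \<Rightarrow> 'a \<Rightarrow> 'a set \<times> ('a \<Rightarrow> 'e)" where
  "chart_at M p = (SOME c. c \<in> atlas M \<and> p \<in> fst c)"

definition tangent_map ::
  "('a, 'e::real_normed_vector) manifold \<Rightarrow> ('b, 'f::real_normed_vector) manifold \<Rightarrow>
   ('a \<Rightarrow> 'b) \<Rightarrow> 'a \<Rightarrow> ('e \<Rightarrow>\<^sub>L 'f)"
where
  "tangent_map M N f p =
     (case chart_at M p of (U, \<phi>) \<Rightarrow> case chart_at N (f p) of (V, \<psi>) \<Rightarrow>
        Blinfun (frechet_derivative (\<psi> \<circ> f \<circ> inv_into U \<phi>) (at (\<phi> p))))"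


section \<open>Lie groups\<close>

definition lie_group :: "'g monoid \<Rightarrow> ('g, 'e::real_normed_vector) manifold \<Rightarrow> bool" where
  "lie_group G M \<longleftrightarrow> group G \<and> smooth_manifold M \<and> topspace (mtop M) = carrier G \<and>
     smooth_map (prod_manifold M M) M (\<lambda>(x, y). x \<otimes>\<^bsub>G\<^esub> y) \<and> smooth_map M M (m_inv G)"

text \<open>A Lie subgroup is given by the manifold \<open>S\<close> whose underlying set is the subgroup. It is an
  immersed submanifold; its topology may be finer than the subspace topology.\<close>

definition lie_subgroup ::
  "'g monoid \<Rightarrow> ('g, 'e::real_normed_vector) manifold \<Rightarrow> ('g, 'f::real_normed_vector) manifold \<Rightarrow> bool"
where
  "lie_subgroup G M S \<longleftrightarrow> subgroup (topspace (mtop S)) G \<and>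
     lie_group (G\<lparr>carrier := topspace (mtop S)\<rparr>) S \<and> smooth_map S M (\<lambda>x. x) \<and>
     (\<forall>p \<in> topspace (mtop S). inj (blinfun_apply (tangent_map S M (\<lambda>x. x) p)))"

text \<open>The Lie algebra is the tangent space at the identity, hence it is the model space
  \<open>'e\<close>, and its dual is \<open>'e \<Rightarrow>\<^sub>L real\<close>.\<close>

definition Ad :: "'g monoid \<Rightarrow> ('g, 'e::real_normed_vector) manifold \<Rightarrow> 'g \<Rightarrow> ('e \<Rightarrow>\<^sub>L 'e)" where
  "Ad G M x = tangent_map M M (\<lambda>y. x \<otimes>\<^bsub>G\<^esub> y \<otimes>\<^bsub>G\<^esub> inv\<^bsub>G\<^esub> x) \<one>\<^bsub>G\<^esub>"

definition coAd ::
  "'g monoid \<Rightarrow> ('g, 'e::real_normed_vector) manifold \<Rightarrow> 'g \<Rightarrow> ('e \<Rightarrow>\<^sub>L real) \<Rightarrow> ('e \<Rightarrow>\<^sub>L real)"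
where
  "coAd G M x \<alpha> = \<alpha> o\<^sub>L Ad G M x"

text \<open>The covector \<open>x\<^sup>-\<^sup>1 \<alpha>\<close> at the identity, for a covector \<open>\<alpha>\<close> at \<open>x\<close>.\<close>

definition left_pullback ::
  "'g monoid \<Rightarrow> ('g, 'e::real_normed_vector) manifold \<Rightarrow> 'g \<Rightarrow> ('e \<Rightarrow>\<^sub>L real) \<Rightarrow> ('e \<Rightarrow>\<^sub>L real)"
where
  "left_pullback G M x \<alpha> = \<alpha> o\<^sub>L tangent_map M M (\<lambda>y. x \<otimes>\<^bsub>G\<^esub> y) \<one>\<^bsub>G\<^esub>"

definition right_triv_deriv ::
  "'g monoid \<Rightarrow> ('g, 'e::real_normed_vector) manifold \<Rightarrow> ('e \<Rightarrow> 'g) \<Rightarrow> 'e \<Rightarrow> ('e \<Rightarrow>\<^sub>L 'e)"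
where
  "right_triv_deriv G M \<tau> \<xi> =
     tangent_map M M (\<lambda>y. y \<otimes>\<^bsub>G\<^esub> inv\<^bsub>G\<^esub> (\<tau> \<xi>)) (\<tau> \<xi>) o\<^sub>L tangent_map vec_manifold M \<tau> \<xi>"

definition right_triv_deriv_inv ::
  "'g monoid \<Rightarrow> ('g, 'e::real_normed_vector) manifold \<Rightarrow> ('e \<Rightarrow> 'g) \<Rightarrow> 'e \<Rightarrow> ('e \<Rightarrow>\<^sub>L 'e)"
where
  "right_triv_deriv_inv G M \<tau> \<xi> =
     Blinfun (inv_into UNIV (blinfun_apply (right_triv_deriv G M \<tau> \<xi>)))"


section \<open>The discrete covariant field theory\<close>

record ('g, 'e, 'f) field_theory =
  grp :: "'g monoid"
  mfd :: "('g, 'e) manifold"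
  sgrp :: "('g, 'f) manifold"
  dt :: real
  ds :: real
  Kin :: "'e \<Rightarrow> real"
  Ela :: "'e \<Rightarrow> real"
  Pot :: "'g \<Rightarrow> real"
  tau :: "'e \<Rightarrow> 'g"
  tau_dom :: "'e set"

text \<open>\<open>Kin\<close>, \<open>Ela\<close>, \<open>Pot\<close> are the functions \<open>K\<close>, \<open>\<Phi>\<close>, \<open>\<Pi>\<close>. The set \<open>tau_dom\<close> is a
  neighbourhood of the origin in the Lie algebra on which \<open>\<tau>\<close> is a diffeomorphism onto an open subset of the group;
  \<open>\<tau>\<^sup>-\<^sup>1\<close> refers to this restriction.\<close>

definition field_theory ::
  "('g, 'e::real_normed_vector, 'f::real_normed_vector) field_theory \<Rightarrow> bool"
where
  "field_theory T \<longleftrightarrow>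
     lie_group (grp T) (mfd T) \<and> lie_subgroup (grp T) (mfd T) (sgrp T) \<and>
     dt T > 0 \<and> ds T > 0 \<and>
     smooth_map vec_manifold vec_manifold (Kin T) \<and>
     smooth_map vec_manifold vec_manifold (Ela T) \<and>
     smooth_map (mfd T) vec_manifold (Pot T) \<and>
     smooth_map vec_manifold (mfd T) (tau T) \<and> tau T 0 = \<one>\<^bsub>grp T\<^esub> \<and>
     open (tau_dom T) \<and> 0 \<in> tau_dom T \<and> inj_on (tau T) (tau_dom T) \<and>
     openin (mtop (mfd T)) (tau T ` tau_dom T) \<and>
     smooth_map (open_submanifold (mfd T) (tau T ` tau_dom T))
       (open_submanifold vec_manifold (tau_dom T)) (inv_into (tau_dom T) (tau T))"

text \<open>Throughout, \<open>g j a\<close> is the value of the discrete field at time index \<open>j\<close> and space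
  index \<open>a\<close>. The second and third conjunct say that all increments lie in the range where
  \<open>\<tau>\<close> is invertible.\<close>

definition discrete_field ::
  "('g, 'e::real_normed_vector, 'f::real_normed_vector) field_theory \<Rightarrow> nat \<Rightarrow> nat \<Rightarrow>
   (nat \<Rightarrow> nat \<Rightarrow> 'g) \<Rightarrow> bool"
where
  "discrete_field T N A g \<longleftrightarrow>
     (\<forall>j\<le>N. \<forall>a\<le>A. g j a \<in> carrier (grp T)) \<and>
     (\<forall>j<N. \<forall>a<A. inv\<^bsub>grp T\<^esub> (g j a) \<otimes>\<^bsub>grp T\<^esub> g (j + 1) a \<in> tau T ` tau_dom T) \<and>
     (\<forall>j<N. \<forall>a<A. inv\<^bsub>grp T\<^esub> (g j a) \<otimes>\<^bsub>grp T\<^esub> g j (a + 1) \<in> tau T ` tau_dom T)"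

type_synonym triangle = "(nat \<times> nat) \<times> (nat \<times> nat) \<times> (nat \<times> nat)"

definition tri :: "nat \<Rightarrow> nat \<Rightarrow> triangle" where
  "tri j a = ((j, a), (j + 1, a), (j, a + 1))"

definition Lagr ::
  "('g, 'e::real_normed_vector, 'f::real_normed_vector) field_theory \<Rightarrow> triangle \<Rightarrow>
   'g \<Rightarrow> 'e \<Rightarrow> 'e \<Rightarrow> real"
where
  "Lagr T \<Delta> x \<xi> \<eta> = dt T * ds T * (Kin T \<xi> - Ela T \<eta> - Pot T x)"

definition H_invariant ::
  "('g, 'e::real_normed_vector, 'f::real_normed_vector) field_theory \<Rightarrow> nat \<Rightarrow> nat \<Rightarrow> bool"
where
  "H_invariant T N A \<longleftrightarrow>
     (\<forall>j<N. \<forall>a<A. \<forall>h \<in> topspace (mtop (sgrp T)). \<forall>x \<in> carrier (grp T). \<forall>\<xi> \<eta>.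
        Lagr T (tri j a) (h \<otimes>\<^bsub>grp T\<^esub> x) \<xi> \<eta> = Lagr T (tri j a) x \<xi> \<eta>)"

context
  fixes T :: "('g, 'e::real_normed_vector, 'f::real_normed_vector) field_theory"
    and g :: "nat \<Rightarrow> nat \<Rightarrow> 'g"
begin

definition xi :: "nat \<Rightarrow> nat \<Rightarrow> 'e" where
  "xi j a = inv_into (tau_dom T) (tau T) (inv\<^bsub>grp T\<^esub> (g j a) \<otimes>\<^bsub>grp T\<^esub> g (j + 1) a) /\<^sub>R dt T"

definition eta :: "nat \<Rightarrow> nat \<Rightarrow> 'e" where
  "eta j a = inv_into (tau_dom T) (tau T) (inv\<^bsub>grp T\<^esub> (g j a) \<otimes>\<^bsub>grp T\<^esub> g j (a + 1)) /\<^sub>R ds T"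

definition mu :: "nat \<Rightarrow> nat \<Rightarrow> ('e \<Rightarrow>\<^sub>L real)" where
  "mu j a = tangent_map vec_manifold vec_manifold (Kin T) (xi j a) o\<^sub>L
     right_triv_deriv_inv (grp T) (mfd T) (tau T) (dt T *\<^sub>R xi j a)"

definition lam :: "nat \<Rightarrow> nat \<Rightarrow> ('e \<Rightarrow>\<^sub>L real)" where
  "lam j a = tangent_map vec_manifold vec_manifold (Ela T) (eta j a) o\<^sub>L
     right_triv_deriv_inv (grp T) (mfd T) (tau T) (ds T *\<^sub>R eta j a)"

abbreviation Ad_star :: "'g \<Rightarrow> ('e \<Rightarrow>\<^sub>L real) \<Rightarrow> ('e \<Rightarrow>\<^sub>L real)" where
  "Ad_star \<equiv> coAd (grp T) (mfd T)"

definition Ad_star_mu :: "nat \<Rightarrow> nat \<Rightarrow> ('e \<Rightarrow>\<^sub>L real)" where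
  "Ad_star_mu j a = Ad_star (tau T (dt T *\<^sub>R xi j a)) (mu j a)"

definition Ad_star_lam :: "nat \<Rightarrow> nat \<Rightarrow> ('e \<Rightarrow>\<^sub>L real)" where
  "Ad_star_lam j a = Ad_star (tau T (ds T *\<^sub>R eta j a)) (lam j a)"

definition force :: "nat \<Rightarrow> nat \<Rightarrow> ('e \<Rightarrow>\<^sub>L real)" where
  "force j a = left_pullback (grp T) (mfd T) (g j a)
     (tangent_map (mfd T) vec_manifold (Pot T) (g j a))"

definition DCEL :: "nat \<Rightarrow> nat \<Rightarrow> bool" where
  "DCEL N A \<longleftrightarrow> (\<forall>j\<in>{1..<N}. \<forall>a\<in>{1..<A}.
     (- mu j a + Ad_star_mu (j - 1) a) /\<^sub>R dt T
     + (lam j a - Ad_star_lam j (a - 1)) /\<^sub>R ds T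
     - force j a = 0)"

definition zero_traction :: "nat \<Rightarrow> nat \<Rightarrow> bool" where
  "zero_traction N A \<longleftrightarrow> (\<forall>j\<in>{1..<N}.
     (- mu j 0 + Ad_star_mu (j - 1) 0) /\<^sub>R dt T + lam j 0 /\<^sub>R ds T = force j 0 \<and>
     Ad_star_lam j (A - 1) = 0)"

definition zero_momentum :: "nat \<Rightarrow> nat \<Rightarrow> bool" where
  "zero_momentum N A \<longleftrightarrow> (\<forall>a\<in>{1..<A}.
     - (mu 0 a /\<^sub>R dt T) + (lam 0 a - Ad_star_lam 0 (a - 1)) /\<^sub>R ds T = force 0 a \<and>
     Ad_star_mu (N - 1) a = 0)"

text \<open>The dual \<open>i\<^sup>*\<close> of the inclusion of Lie algebras, that is, of the tangent map of the
  inclusion of the subgroup.\<close>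

definition i_star :: "('e \<Rightarrow>\<^sub>L real) \<Rightarrow> ('f \<Rightarrow>\<^sub>L real)" where
  "i_star \<alpha> = \<alpha> o\<^sub>L tangent_map (sgrp T) (mfd T) (\<lambda>x. x) \<one>\<^bsub>grp T\<^esub>"

definition J1 :: "nat \<Rightarrow> nat \<Rightarrow> ('f \<Rightarrow>\<^sub>L real)" where
  "J1 j a = i_star (Ad_star (inv\<^bsub>grp T\<^esub> (g j a))
     (- (ds T *\<^sub>R mu j a) + dt T *\<^sub>R lam j a - (dt T * ds T) *\<^sub>R force j a))"

definition J2 :: "nat \<Rightarrow> nat \<Rightarrow> ('f \<Rightarrow>\<^sub>L real)" where
  "J2 j a = i_star (Ad_star (inv\<^bsub>grp T\<^esub> (g (j + 1) a)) (ds T *\<^sub>R Ad_star_mu j a))"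

definition J3 :: "nat \<Rightarrow> nat \<Rightarrow> ('f \<Rightarrow>\<^sub>L real)" where
  "J3 j a = i_star (Ad_star (inv\<^bsub>grp T\<^esub> (g j (a + 1))) (- (dt T *\<^sub>R Ad_star_lam j a)))"

text \<open>The arguments are \<open>B\<close>, \<open>C\<close> (space) and \<open>K\<close>, \<open>L\<close> (time), in this order.\<close>

definition Noether_sum :: "nat \<Rightarrow> nat \<Rightarrow> nat \<Rightarrow> nat \<Rightarrow> ('f \<Rightarrow>\<^sub>L real)" where
  "Noether_sum B C K L =
     (\<Sum>j=K+1..L. J1 j B + J2 (j - 1) B + J3 j C)
     + (\<Sum>a=B+1..C. J1 K a + J2 L a + J3 K (a - 1))
     + J1 K B + J2 L B + J3 K C"

text \<open>\<open>JL\<close> and \<open>JN\<close> are the momentum maps of the time-evolution and of the space-evolution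
  Lagrangian, at time index \<open>j\<close> and at space index \<open>a\<close> respectively.\<close>

definition JL_minus :: "nat \<Rightarrow> nat \<Rightarrow> ('f \<Rightarrow>\<^sub>L real)" where
  "JL_minus A j = - (\<Sum>a<A. J1 j a + J3 j a)"

definition JL_plus :: "nat \<Rightarrow> nat \<Rightarrow> ('f \<Rightarrow>\<^sub>L real)" where
  "JL_plus A j = (\<Sum>a<A. J2 j a)"

definition JN_minus :: "nat \<Rightarrow> nat \<Rightarrow> ('f \<Rightarrow>\<^sub>L real)" where
  "JN_minus N a = - (\<Sum>j<N. J1 j a + J2 j a)"

definition JN_plus :: "nat \<Rightarrow> nat \<Rightarrow> ('f \<Rightarrow>\<^sub>L real)" where
  "JN_plus N a = (\<Sum>j<N. J3 j a)"

end

definition conserved :: "nat \<Rightarrow> (nat \<Rightarrow> 'v) \<Rightarrow> bool" where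
  "conserved n J \<longleftrightarrow> (\<forall>k<n. \<forall>l<n. J k = J l)"

definition noether_setting ::
  "('g, 'e::real_normed_vector, 'f::real_normed_vector) field_theory \<Rightarrow> nat \<Rightarrow> nat \<Rightarrow>
   (nat \<Rightarrow> nat \<Rightarrow> 'g) \<Rightarrow> bool"
where
  "noether_setting T N A g \<longleftrightarrow> 1 \<le> N \<and> 1 \<le> A \<and> field_theory T \<and> H_invariant T N A \<and>
     discrete_field T N A g \<and> DCEL T g N A"

text \<open>Prescribed boundary values: \<open>u\<close>, \<open>v\<close> are the given data at the two extremities.\<close>

definition prescribed_temporal ::
  "nat \<Rightarrow> nat \<Rightarrow> (nat \<Rightarrow> 'g) \<Rightarrow> (nat \<Rightarrow> 'g) \<Rightarrow> (nat \<Rightarrow> nat \<Rightarrow> 'g) \<Rightarrow> bool"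
where
  "prescribed_temporal N A u v g \<longleftrightarrow> (\<forall>a\<le>A. g 0 a = u a \<and> g N a = v a)"

definition prescribed_spatial ::
  "nat \<Rightarrow> nat \<Rightarrow> (nat \<Rightarrow> 'g) \<Rightarrow> (nat \<Rightarrow> 'g) \<Rightarrow> (nat \<Rightarrow> nat \<Rightarrow> 'g) \<Rightarrow> bool"
where
  "prescribed_spatial N A u v g \<longleftrightarrow> (\<forall>j\<le>N. g j 0 = u j \<and> g j A = v j)"

end

theory Submission
  imports Defs
begin

text \<open>
  Everything follows from two linear relations between the momentum maps, one for triangles and one for vertices.

  For a triangle, \<open>J1 + J2 + J3 = 0\<close> (\<open>triangle_Noether\<close>). Since \<open>Ad\<close> is a homomorphism, the
  momentum attached to the far end of an increment, transported back, cancels the one at the near end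
  (\<open>coAd_inv_mult\<close>). What remains is the differential of the potential along the orbit of the subgroup, which is
  \<open>0\<close> by invariance (\<open>invariant_differential_vanishes\<close>). Both facts rest on the chain rule for
  tangent maps (\<open>tangent_map_compose\<close>).

  For a vertex, the sum of the momentum maps of the three triangles meeting there is, up to a factor, the discrete
  covariant Euler-Lagrange expression pulled back to the dual of the Lie algebra of the subgroup
  (\<open>J1_J2_J3_at_vertex\<close>), hence \<open>0\<close> for solutions.

  The covariant Noether theorem compares the two ways of summing over a rectangle: by triangles or by vertices. The sum over
  the boundary is the difference of the two, and both vanish (\<open>boundary_sum\<close>). For the evolutionary momentum
  maps, \<open>J+ = J-\<close> is the sum of the triangle relations over one level, and conservation is the sum of the vertex
  relations over one level. That sum leaves one term at each end of the level, and the natural boundary conditions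
  make these end terms vanish.

  Conservation in the other direction lacks its end conditions. Two solutions of the discrete wave equation on the line,
  exchanged by transposing time and space, show that it can fail.
\<close>

section \<open>Tangent maps and the chain rule\<close>

definition chart_rep ::
  "('a, 'e::real_normed_vector) manifold \<Rightarrow> ('b, 'f::real_normed_vector) manifold \<Rightarrow>
   ('a \<Rightarrow> 'b) \<Rightarrow> 'a \<Rightarrow> 'e \<Rightarrow> 'f"
where
  "chart_rep M N f p =
     snd (chart_at N (f p)) \<circ> f \<circ> inv_into (fst (chart_at M p)) (snd (chart_at M p))"

text \<open>Differentiability of the single coordinate expression that enters \<open>tangent_map\<close>. Continuity is required on the
  whole manifold: it makes the image of a neighbourhood of \<open>p\<close> lie in the chart domain around
  \<open>f p\<close>, without which coordinate expressions could not be composed.\<close>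

definition differentiable_map_at ::
  "('a, 'e::real_normed_vector) manifold \<Rightarrow> ('b, 'f::real_normed_vector) manifold \<Rightarrow>
   ('a \<Rightarrow> 'b) \<Rightarrow> 'a \<Rightarrow> bool"
where
  "differentiable_map_at M N f p \<longleftrightarrow>
     p \<in> topspace (mtop M) \<and> continuous_map (mtop M) (mtop N) f \<and>
     chart_rep M N f p differentiable (at (snd (chart_at M p) p))"

lemma tangent_map_chart_rep:
  "tangent_map M N f p =
     Blinfun (frechet_derivative (chart_rep M N f p) (at (snd (chart_at M p) p)))"
  by (simp add: tangent_map_def chart_rep_def split_def)

lemma chart_at_props:
  assumes "smooth_manifold M" "p \<in> topspace (mtop M)"
  shows "chart_at M p \<in> atlas M" "p \<in> fst (chart_at M p)"
    "chart_on (mtop M) (fst (chart_at M p)) (snd (chart_at M p))"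
proof -
  have "\<Union> (fst ` atlas M) = topspace (mtop M)"
    using assms(1) unfolding smooth_manifold_def by blast
  then have "p \<in> \<Union> (fst ` atlas M)" using assms(2) by simp
  then have "\<exists>c. c \<in> atlas M \<and> p \<in> fst c" by (auto simp del: split_paired_Ex)
  then have *: "chart_at M p \<in> atlas M \<and> p \<in> fst (chart_at M p)"
    unfolding chart_at_def by (rule someI_ex)
  then show "chart_at M p \<in> atlas M" "p \<in> fst (chart_at M p)" by auto
  show "chart_on (mtop M) (fst (chart_at M p)) (snd (chart_at M p))"
    using * assms(1) by (auto simp: smooth_manifold_def split_def)
qed

lemma chart_on_inj: "chart_on X U \<phi> \<Longrightarrow> inj_on \<phi> U"
  unfolding chart_on_def homeomorphic_map_def
  by (metis openin_subset topspace_subtopology_subset)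

lemma chart_on_open_image:
  assumes "chart_on X U \<phi>" "openin X W"
  shows "open (\<phi> ` (U \<inter> W))"
proof -
  have "open_map (subtopology X U) (top_of_set (\<phi> ` U)) \<phi>"
    using assms(1) by (auto simp: chart_on_def homeomorphic_imp_open_map)
  moreover have "openin (subtopology X U) (U \<inter> W)"
    using assms(2) by (simp add: openin_subtopology_Int2)
  ultimately have "openin (top_of_set (\<phi> ` U)) (\<phi> ` (U \<inter> W))"
    by (auto simp: open_map_def)
  then show ?thesis
    using assms(1) openin_open_trans by (auto simp: chart_on_def)
qed

text \<open>Germs at \<open>p\<close> correspond to germs at the image of \<open>p\<close> in coordinates. Hence two coordinate expressions that agree
  on the part of the chart lying in some open \<open>W\<close> around \<open>p\<close> have the same derivative at that image.\<close>

lemma inverse_chart_neighbourhood: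
  fixes M :: "('a, 'e::real_normed_vector) manifold"
  assumes M: "smooth_manifold M" and p: "p \<in> topspace (mtop M)"
    and W: "openin (mtop M) W" "p \<in> W"
  obtains S where "open S" "snd (chart_at M p) p \<in> S"
    "\<And>v. v \<in> S \<Longrightarrow> inv_into (fst (chart_at M p)) (snd (chart_at M p)) v \<in> W"
proof -
  let ?U = "fst (chart_at M p)" and ?\<phi> = "snd (chart_at M p)"
  note c = chart_at_props[OF M p]
  show ?thesis
  proof (rule that[of "?\<phi> ` (?U \<inter> W)"])
    show "open (?\<phi> ` (?U \<inter> W))" using chart_on_open_image[OF c(3) W(1)] .
    show "?\<phi> p \<in> ?\<phi> ` (?U \<inter> W)" using c(2) W(2) by auto
    show "inv_into ?U ?\<phi> v \<in> W" if "v \<in> ?\<phi> ` (?U \<inter> W)" for v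
      using that chart_on_inj[OF c(3)] by auto
  qed
qed

lemma inverse_chart_base:
  assumes "smooth_manifold M" "p \<in> topspace (mtop M)"
  shows "inv_into (fst (chart_at M p)) (snd (chart_at M p)) (snd (chart_at M p) p) = p"
  using chart_at_props[OF assms] chart_on_inj by (metis inv_into_f_f)

lemma differentiable_transform_within_open:
  assumes "f differentiable (at x)" "open S" "x \<in> S" "\<And>v. v \<in> S \<Longrightarrow> f v = f' v"
  shows "f' differentiable (at x)"
  using assms has_derivative_transform_within_open unfolding differentiable_def by metis

lemma blinfun_compose_assoc: "(\<alpha> o\<^sub>L \<beta>) o\<^sub>L \<gamma> = \<alpha> o\<^sub>L (\<beta> o\<^sub>L \<gamma>)"
  by (rule blinfun_eqI) simp

lemma tangent_map_cong:
  assumes M: "smooth_manifold M" and p: "p \<in> topspace (mtop M)"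
    and eq: "\<And>x. x \<in> topspace (mtop M) \<Longrightarrow> f x = f' x"
    and d: "differentiable_map_at M N f p"
  shows "tangent_map M N f p = tangent_map M N f' p"
proof -
  let ?U = "fst (chart_at M p)" and ?\<phi> = "snd (chart_at M p)"
  obtain S where S: "open S" "?\<phi> p \<in> S"
    "\<And>v. v \<in> S \<Longrightarrow> inv_into ?U ?\<phi> v \<in> topspace (mtop M)"
    using inverse_chart_neighbourhood[OF M p openin_topspace p] by metis
  have r: "chart_rep M N f p v = chart_rep M N f' p v" if "v \<in> S" for v
    using S(3)[OF that] eq p by (simp add: chart_rep_def)
  have df: "chart_rep M N f p differentiable at (?\<phi> p)"
    using d by (simp add: differentiable_map_at_def)
  show "tangent_map M N f p = tangent_map M N f' p"
    unfolding tangent_map_chart_rep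
    using frechet_derivative_transform_within_open[OF df S(1,2) r] by simp
qed

text \<open>The chain rule. In coordinates \<open>h \<circ> f\<close> is the composite of the expressions of \<open>h\<close> and \<open>f\<close>
  only where \<open>f\<close> takes values in the chart around \<open>f p\<close>; by continuity this is a
  neighbourhood of \<open>p\<close>, which is enough for derivatives.\<close>

lemma tangent_map_compose:
  assumes M: "smooth_manifold M" and N: "smooth_manifold N"
    and f: "differentiable_map_at M N f p" and h: "differentiable_map_at N P h (f p)"
  shows "tangent_map M P (\<lambda>x. h (f x)) p = tangent_map N P h (f p) o\<^sub>L tangent_map M N f p"
    and "differentiable_map_at M P (\<lambda>x. h (f x)) p"
proof -
  let ?U = "fst (chart_at M p)" and ?\<phi> = "snd (chart_at M p)"
  let ?V = "fst (chart_at N (f p))" and ?\<psi> = "snd (chart_at N (f p))"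
  let ?F = "chart_rep M N f p" and ?H = "chart_rep N P h (f p)"
  have p: "p \<in> topspace (mtop M)" and fp: "f p \<in> topspace (mtop N)"
    and cf: "continuous_map (mtop M) (mtop N) f" and ch: "continuous_map (mtop N) (mtop P) h"
    and dF: "?F differentiable at (?\<phi> p)" and dH: "?H differentiable at (?\<psi> (f p))"
    using f h by (auto simp: differentiable_map_at_def)
  note c = chart_at_props[OF N fp]
  define W where "W = {x \<in> topspace (mtop M). f x \<in> ?V}"
  have "openin (mtop N) ?V" using c(3) by (simp add: chart_on_def)
  then have W: "openin (mtop M) W" "p \<in> W"
    unfolding W_def using cf p c(2) by (auto intro: openin_continuous_map_preimage)
  obtain S where S: "open S" "?\<phi> p \<in> S" "\<And>v. v \<in> S \<Longrightarrow> inv_into ?U ?\<phi> v \<in> W"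
    using inverse_chart_neighbourhood[OF M p W] by metis
  have Fp: "?F (?\<phi> p) = ?\<psi> (f p)"
    using inverse_chart_base[OF M p] by (simp add: chart_rep_def)
  have r: "(?H \<circ> ?F) v = chart_rep M P (\<lambda>x. h (f x)) p v" if "v \<in> S" for v
    using S(3)[OF that] chart_on_inj[OF c(3)] by (simp add: chart_rep_def W_def)
  have dHF: "(?H \<circ> ?F) differentiable at (?\<phi> p)"
    using dF dH Fp by (simp add: differentiable_chain_at)
  have "frechet_derivative (chart_rep M P (\<lambda>x. h (f x)) p) (at (?\<phi> p))
      = frechet_derivative (?H \<circ> ?F) (at (?\<phi> p))"
    by (rule frechet_derivative_transform_within_open[OF dHF S(1,2) r, symmetric])
  also have "\<dots> = frechet_derivative ?H (at (?\<psi> (f p))) \<circ> frechet_derivative ?F (at (?\<phi> p))"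
    using frechet_derivative_compose[of ?F "?\<phi> p" ?H] dF dH Fp by simp
  finally have e: "frechet_derivative (chart_rep M P (\<lambda>x. h (f x)) p) (at (?\<phi> p)) = \<dots>" .
  have bF: "bounded_linear (frechet_derivative ?F (at (?\<phi> p)))"
    and bH: "bounded_linear (frechet_derivative ?H (at (?\<psi> (f p))))"
    using dF dH by (auto simp: frechet_derivative_works has_derivative_bounded_linear)
  show "tangent_map M P (\<lambda>x. h (f x)) p = tangent_map N P h (f p) o\<^sub>L tangent_map M N f p"
    unfolding tangent_map_chart_rep e
    by (rule blinfun_eqI)
      (simp add: bounded_linear_Blinfun_apply bF bH bounded_linear_compose[OF bH bF] o_def)
  have "chart_rep M P (\<lambda>x. h (f x)) p differentiable at (?\<phi> p)"
    by (rule differentiable_transform_within_open[OF dHF S(1,2) r])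
  then show "differentiable_map_at M P (\<lambda>x. h (f x)) p"
    using p continuous_map_compose[OF cf ch]
    by (simp add: differentiable_map_at_def o_def)
qed

lemma tangent_map_const:
  assumes M: "smooth_manifold M" and p: "p \<in> topspace (mtop M)"
    and eq: "\<And>x. x \<in> topspace (mtop M) \<Longrightarrow> f x = c"
    and d: "differentiable_map_at M N f p"
  shows "tangent_map M N f p = 0"
proof -
  have "tangent_map M N f p = tangent_map M N (\<lambda>_. c) p"
    using tangent_map_cong[OF M p eq d] .
  also have "\<dots> = Blinfun (\<lambda>_. 0)"
    by (simp add: tangent_map_chart_rep chart_rep_def o_def)
  finally show ?thesis
    by (simp add: zero_blinfun_def)
qed

lemma smooth_on_imp_differentiable: "smooth_on S f \<Longrightarrow> x \<in> S \<Longrightarrow> f differentiable (at x)"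
  unfolding smooth_on_def by (metis Ck_on.simps(2))

lemma smooth_map_imp_differentiable_map_at:
  assumes M: "smooth_manifold M" and N: "smooth_manifold N"
    and f: "smooth_map M N f" and p: "p \<in> topspace (mtop M)"
  shows "differentiable_map_at M N f p"
proof -
  have cf: "continuous_map (mtop M) (mtop N) f" using f by (simp add: smooth_map_def)
  then have fp: "f p \<in> topspace (mtop N)" using p by (auto simp: continuous_map_def)
  note c = chart_at_props[OF M p] and d = chart_at_props[OF N fp]
  have "smooth_on (snd (chart_at M p) ` (fst (chart_at M p) \<inter> f -` fst (chart_at N (f p))))
     (chart_rep M N f p)"
    using f c(1) d(1) unfolding smooth_map_def chart_rep_def by (auto simp: split_def)
  then show ?thesis
    using c(2) d(2) cf p
    by (auto simp: differentiable_map_at_def intro!: smooth_on_imp_differentiable)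
qed

section \<open>Vector spaces as manifolds\<close>

lemma frechet_derivative_eqI: "(f has_derivative D) (at x) \<Longrightarrow> frechet_derivative f (at x) = D"
  by (metis frechet_derivative_at)

lemma smooth_on_const: "smooth_on S (\<lambda>_. c)"
proof -
  have "Ck_on k S (\<lambda>_. c)" for k
    by (induction k arbitrary: c) auto
  then show ?thesis by (simp add: smooth_on_def)
qed

text \<open>Reduces smoothness to that of the directional derivatives, so linear maps, whose derivative is constant, and then
  quadratic ones, whose derivative is linear, are smooth.\<close>

lemma smooth_onI_derivative:
  assumes f: "\<And>x. (f has_derivative D x) (at x)" and D: "\<And>v. smooth_on S (\<lambda>x. D x v)"
  shows "smooth_on S f"
proof -
  have e: "frechet_derivative f (at x) = D x" for x
    by (rule frechet_derivative_eqI[OF f])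
  have "Ck_on k S f" for k
  proof (cases k)
    case 0
    then show ?thesis
      using f by (auto intro!: continuous_at_imp_continuous_on has_derivative_continuous)
  next
    case (Suc m)
    then show ?thesis
      using D f by (auto simp: e differentiable_def smooth_on_def)
  qed
  then show ?thesis by (simp add: smooth_on_def)
qed

lemma smooth_on_bounded_linear:
  assumes "bounded_linear f"
  shows "smooth_on S f"
  by (rule smooth_onI_derivative[OF bounded_linear_imp_has_derivative[OF assms] smooth_on_const])

lemma second_countable_euclidean:
  "second_countable (euclidean :: 'a::second_countable_topology topology)"
proof -
  obtain B :: "'a set set" where B: "countable B" "topological_basis B"
    using ex_countable_basis by blast
  have "\<exists>U\<in>B. x \<in> U \<and> U \<subseteq> V" if "open V" "x \<in> V" for V and x :: 'a
    using topological_basisE[OF B(2) that] by metis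
  then show ?thesis
    unfolding second_countable_def
    using B(1) topological_basis_open[OF B(2)]
    by (intro exI[of _ B]) auto
qed

lemma inv_into_UNIV_ident [simp]: "inv_into UNIV (\<lambda>x. x) = (\<lambda>x. x)"
  by (rule ext) (simp add: inv_into_f_eq)

lemma smooth_manifold_vec: "smooth_manifold (vec_manifold :: ('e::euclidean_space, 'e) manifold)"
proof -
  have "\<exists>B :: 'e set. finite B \<and> span B = UNIV"
    using span_Basis finite_Basis by blast
  moreover have "smooth_on UNIV (\<lambda>x::'e. x)"
    by (rule smooth_on_bounded_linear) (rule bounded_linear_ident)
  moreover have "homeomorphic_map euclidean euclidean (\<lambda>x::'e. x)"
    unfolding id_def[symmetric] by simp
  ultimately show ?thesis
    unfolding smooth_manifold_def vec_manifold_def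
    by (simp add: second_countable_euclidean chart_on_def o_def)
qed

lemma vec_manifold_simps [simp]:
  "mtop vec_manifold = euclidean" "atlas vec_manifold = {(UNIV, \<lambda>x. x)}"
  by (simp_all add: vec_manifold_def)

lemma open_submanifold_UNIV: "open_submanifold vec_manifold UNIV = vec_manifold"
  by (simp add: open_submanifold_def vec_manifold_def)

lemma smooth_map_vec:
  "smooth_map vec_manifold vec_manifold f \<longleftrightarrow> continuous_on UNIV f \<and> smooth_on UNIV f"
  by (simp add: smooth_map_def o_def)

lemma chart_at_vec: "chart_at vec_manifold q = (UNIV, \<lambda>x. x)"
  unfolding chart_at_def by (rule some_equality) auto

lemma tangent_map_vec:
  "tangent_map vec_manifold vec_manifold f p = Blinfun (frechet_derivative f (at p))"
  by (simp add: tangent_map_def chart_at_vec o_def)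

lemma Blinfun_ident: "Blinfun (\<lambda>x. x) = id_blinfun"
  by (rule blinfun_eqI) (simp add: bounded_linear_Blinfun_apply bounded_linear_ident)

lemma tangent_map_vec_translation:
  assumes "\<And>x. f x = x + c"
  shows "tangent_map vec_manifold vec_manifold f p = id_blinfun"
proof -
  have "(f has_derivative (\<lambda>x. x)) (at p)"
    unfolding assms[THEN ext] by (auto intro!: derivative_eq_intros)
  then show ?thesis by (simp add: tangent_map_vec frechet_derivative_eqI Blinfun_ident)
qed

section \<open>The adjoint representation and invariant functions\<close>

text \<open>Translations are restrictions of the multiplication to the slices \<open>{x} \<times> G\<close> and
  \<open>G \<times> {x}\<close>. In product coordinates a slice is an affine subspace, so the coordinate expression of a
  translation is that of the multiplication composed with an affine map.\<close>

lemma lie_group_differentiable_mult: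
  assumes G: "lie_group G M" and x: "x \<in> carrier G" and y: "y \<in> carrier G"
  shows "differentiable_map_at M M (\<lambda>z. x \<otimes>\<^bsub>G\<^esub> z) y"
    and "differentiable_map_at M M (\<lambda>z. z \<otimes>\<^bsub>G\<^esub> x) y"
proof -
  have grp: "group G" and M: "smooth_manifold M" and top: "topspace (mtop M) = carrier G"
    and m: "smooth_map (prod_manifold M M) M (\<lambda>(x, y). x \<otimes>\<^bsub>G\<^esub> y)"
    using G by (auto simp: lie_group_def)
  have cm: "continuous_map (prod_topology (mtop M) (mtop M)) (mtop M) (\<lambda>(x, y). x \<otimes>\<^bsub>G\<^esub> y)"
    using m by (simp add: smooth_map_def prod_manifold_def)
  interpret group G by (rule grp)
  have xM: "x \<in> topspace (mtop M)" and yM: "y \<in> topspace (mtop M)" using x y top by auto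
  \<comment> \<open>The multiplication is differentiable in the product of the charts chosen at \<open>u\<close> and \<open>v\<close>.\<close>
  have rep: "(snd (chart_at M (u \<otimes>\<^bsub>G\<^esub> v)) \<circ> (\<lambda>(x, y). x \<otimes>\<^bsub>G\<^esub> y) \<circ>
      inv_into (fst (chart_at M u) \<times> fst (chart_at M v)) (map_prod (snd (chart_at M u)) (snd (chart_at M v))))
      differentiable at (snd (chart_at M u) u, snd (chart_at M v) v)"
    if u: "u \<in> carrier G" and v: "v \<in> carrier G" for u v
  proof -
    have uv: "u \<in> topspace (mtop M)" "v \<in> topspace (mtop M)" "u \<otimes>\<^bsub>G\<^esub> v \<in> topspace (mtop M)"
      using u v top by auto
    note cu = chart_at_props[OF M uv(1)] and cv = chart_at_props[OF M uv(2)]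
      and cuv = chart_at_props[OF M uv(3)]
    let ?UV = "fst (chart_at M u) \<times> fst (chart_at M v)"
      and ?\<phi> = "map_prod (snd (chart_at M u)) (snd (chart_at M v))"
      and ?W = "fst (chart_at M (u \<otimes>\<^bsub>G\<^esub> v))" and ?\<psi> = "snd (chart_at M (u \<otimes>\<^bsub>G\<^esub> v))"
    have "(?UV, ?\<phi>) \<in> atlas (prod_manifold M M)"
      unfolding prod_manifold_def using cu(1) cv(1)
      by (simp, metis prod.collapse)
    moreover have "(?W, ?\<psi>) \<in> atlas M" using cuv(1) by simp
    ultimately have s: "smooth_on (?\<phi> ` (?UV \<inter> (\<lambda>(x, y). x \<otimes>\<^bsub>G\<^esub> y) -` ?W))
        (?\<psi> \<circ> (\<lambda>(x, y). x \<otimes>\<^bsub>G\<^esub> y) \<circ> inv_into ?UV ?\<phi>)"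
      using m unfolding smooth_map_def by blast
    have "(u, v) \<in> ?UV \<inter> (\<lambda>(x, y). x \<otimes>\<^bsub>G\<^esub> y) -` ?W"
      using cu(2) cv(2) cuv(2) by simp
    then have "?\<phi> (u, v) \<in> ?\<phi> ` (?UV \<inter> (\<lambda>(x, y). x \<otimes>\<^bsub>G\<^esub> y) -` ?W)" by (rule imageI)
    from smooth_on_imp_differentiable[OF s this] show ?thesis by simp
  qed
  \<comment> \<open>The inverse of a product chart acts componentwise, but only on the product of the two chart images:
    elsewhere \<^const>\<open>inv_into\<close> has no prescribed value.\<close>
  have inv_pair: "inv_into (fst (chart_at M u) \<times> fst (chart_at M v))
        (map_prod (snd (chart_at M u)) (snd (chart_at M v))) (r, s) =
      (inv_into (fst (chart_at M u)) (snd (chart_at M u)) r,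
       inv_into (fst (chart_at M v)) (snd (chart_at M v)) s)"
    if u: "u \<in> carrier G" and v: "v \<in> carrier G"
      and r: "r \<in> snd (chart_at M u) ` fst (chart_at M u)"
      and s: "s \<in> snd (chart_at M v) ` fst (chart_at M v)" for u v r s
  proof -
    have "u \<in> topspace (mtop M)" "v \<in> topspace (mtop M)" using u v top by auto
    then have "inj_on (snd (chart_at M u)) (fst (chart_at M u))"
      "inj_on (snd (chart_at M v)) (fst (chart_at M v))"
      using chart_at_props(3)[OF M] chart_on_inj by blast+
    moreover from this have "inj_on (map_prod (snd (chart_at M u)) (snd (chart_at M v)))
        (fst (chart_at M u) \<times> fst (chart_at M v))"
      by (rule map_prod_inj_on)
    ultimately show ?thesis using r s by (auto intro!: inv_into_f_eq)
  qed
  note cx = chart_at_props[OF M xM] and cy = chart_at_props[OF M yM]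
  let ?X = "snd (chart_at M x) x" and ?Y = "snd (chart_at M y) y"
  let ?S = "snd (chart_at M y) ` fst (chart_at M y)"
  have S: "open ?S" "?Y \<in> ?S" using cy by (auto simp: chart_on_def)
  have X: "?X \<in> snd (chart_at M x) ` fst (chart_at M x)" using cx by auto
  have diff: "chart_rep M M f y differentiable at ?Y"
    if "F differentiable at (e ?Y)" "e differentiable at ?Y"
      "\<And>v. v \<in> ?S \<Longrightarrow> F (e v) = chart_rep M M f y v" for f e and F :: "_ \<times> _ \<Rightarrow> _"
  proof -
    have "(F \<circ> e) differentiable at ?Y" using that(1,2) by (simp add: differentiable_chain_at)
    then show ?thesis
      by (rule differentiable_transform_within_open[OF _ S]) (simp add: that(3))
  qed
  have "chart_rep M M (\<lambda>z. x \<otimes>\<^bsub>G\<^esub> z) y differentiable at ?Y"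
    by (rule diff[where e = "\<lambda>v. (?X, v)", OF rep[OF x y]])
      (auto simp: inv_pair[OF x y X] chart_rep_def inverse_chart_base[OF M xM] differentiable_def
        intro!: exI derivative_eq_intros)
  moreover have "continuous_map (mtop M) (mtop M) (\<lambda>z. x \<otimes>\<^bsub>G\<^esub> z)"
    using continuous_map_compose[OF _ cm, of "mtop M" "\<lambda>z. (x, z)"] xM
    by (simp add: continuous_map_pairwise o_def)
  ultimately show "differentiable_map_at M M (\<lambda>z. x \<otimes>\<^bsub>G\<^esub> z) y"
    using yM by (simp add: differentiable_map_at_def)
  have "chart_rep M M (\<lambda>z. z \<otimes>\<^bsub>G\<^esub> x) y differentiable at ?Y"
    by (rule diff[where e = "\<lambda>v. (v, ?X)", OF rep[OF y x]])
      (auto simp: inv_pair[OF y x _ X] chart_rep_def inverse_chart_base[OF M xM] differentiable_def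
        intro!: exI derivative_eq_intros)
  moreover have "continuous_map (mtop M) (mtop M) (\<lambda>z. z \<otimes>\<^bsub>G\<^esub> x)"
    using continuous_map_compose[OF _ cm, of "mtop M" "\<lambda>z. (z, x)"] xM
    by (simp add: continuous_map_pairwise o_def)
  ultimately show "differentiable_map_at M M (\<lambda>z. z \<otimes>\<^bsub>G\<^esub> x) y"
    using yM by (simp add: differentiable_map_at_def)
qed

lemma lie_group_differentiable_conj:
  assumes G: "lie_group G M" and x: "x \<in> carrier G" and y: "y \<in> carrier G"
  shows "differentiable_map_at M M (\<lambda>y. x \<otimes>\<^bsub>G\<^esub> y \<otimes>\<^bsub>G\<^esub> inv\<^bsub>G\<^esub> x) y"
proof -
  interpret group G using G by (simp add: lie_group_def)
  have M: "smooth_manifold M" using G by (simp add: lie_group_def)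
  show ?thesis
    using tangent_map_compose(2)[OF M M lie_group_differentiable_mult(1)[OF G x y]
        lie_group_differentiable_mult(2)[OF G, of "inv\<^bsub>G\<^esub> x"]] x y by simp
qed

text \<open>Conjugation is a homomorphism from \<open>G\<close> to its automorphisms; the chain rule at the common fixed
  point \<open>\<one>\<close> carries this over to \<open>Ad\<close>.\<close>

lemma Ad_mult:
  assumes G: "lie_group G M" and x: "x \<in> carrier G" and y: "y \<in> carrier G"
  shows "Ad G M (x \<otimes>\<^bsub>G\<^esub> y) = Ad G M x o\<^sub>L Ad G M y"
proof -
  interpret group G using G by (simp add: lie_group_def)
  have M: "smooth_manifold M" and top: "topspace (mtop M) = carrier G"
    using G by (auto simp: lie_group_def)
  note d = lie_group_differentiable_conj[OF G]
  have one: "y \<otimes>\<^bsub>G\<^esub> \<one>\<^bsub>G\<^esub> \<otimes>\<^bsub>G\<^esub> inv\<^bsub>G\<^esub> y = \<one>\<^bsub>G\<^esub>" using y by simp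
  have "tangent_map M M (\<lambda>z. x \<otimes>\<^bsub>G\<^esub> y \<otimes>\<^bsub>G\<^esub> z \<otimes>\<^bsub>G\<^esub> inv\<^bsub>G\<^esub> (x \<otimes>\<^bsub>G\<^esub> y)) \<one>\<^bsub>G\<^esub>
      = tangent_map M M (\<lambda>z. x \<otimes>\<^bsub>G\<^esub> (y \<otimes>\<^bsub>G\<^esub> z \<otimes>\<^bsub>G\<^esub> inv\<^bsub>G\<^esub> y) \<otimes>\<^bsub>G\<^esub> inv\<^bsub>G\<^esub> x) \<one>\<^bsub>G\<^esub>"
    by (rule tangent_map_cong[OF M _ _ d])
      (use x y top in \<open>auto simp: inv_mult_group m_assoc\<close>)
  also have "\<dots> = Ad G M x o\<^sub>L Ad G M y"
    using tangent_map_compose(1)[OF M M d[OF y one_closed], of M "\<lambda>z. x \<otimes>\<^bsub>G\<^esub> z \<otimes>\<^bsub>G\<^esub> inv\<^bsub>G\<^esub> x"]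
      d[OF x one_closed] one by (simp add: Ad_def)
  finally show ?thesis by (simp add: Ad_def)
qed

text \<open>A momentum transported over an increment \<open>t\<close> and then expressed in the spatial frame at
  \<open>x \<otimes> t\<close> is the same covector as before the transport, expressed in the spatial frame at \<open>x\<close>. For this reason the
  three momentum maps of a triangle cancel up to the potential term.\<close>

lemma coAd_inv_mult:
  assumes G: "lie_group G M" and x: "x \<in> carrier G" and t: "t \<in> carrier G"
  shows "coAd G M (inv\<^bsub>G\<^esub> (x \<otimes>\<^bsub>G\<^esub> t)) (coAd G M t \<alpha>) = coAd G M (inv\<^bsub>G\<^esub> x) \<alpha>"
proof -
  interpret group G using G by (simp add: lie_group_def)
  have "inv\<^bsub>G\<^esub> x = t \<otimes>\<^bsub>G\<^esub> inv\<^bsub>G\<^esub> (x \<otimes>\<^bsub>G\<^esub> t)"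
    using x t by (simp add: inv_mult_group m_assoc[symmetric])
  then have "Ad G M (inv\<^bsub>G\<^esub> x) = Ad G M t o\<^sub>L Ad G M (inv\<^bsub>G\<^esub> (x \<otimes>\<^bsub>G\<^esub> t))"
    using Ad_mult[OF G t, of "inv\<^bsub>G\<^esub> (x \<otimes>\<^bsub>G\<^esub> t)"] x t by simp
  then show ?thesis by (simp add: coAd_def blinfun_compose_assoc)
qed

lemma coAd_linear:
  "coAd G M x (\<alpha> + \<beta>) = coAd G M x \<alpha> + coAd G M x \<beta>"
  "coAd G M x (\<alpha> - \<beta>) = coAd G M x \<alpha> - coAd G M x \<beta>"
  "coAd G M x (- \<alpha>) = - coAd G M x \<alpha>"
  "coAd G M x (c *\<^sub>R \<alpha>) = c *\<^sub>R coAd G M x \<alpha>"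
  "coAd G M x 0 = 0"
  by (auto intro!: blinfun_eqI simp: coAd_def blinfun.bilinear_simps)

text \<open>The covector is the differential of \<open>h \<mapsto> P (h \<otimes> x)\<close> at the identity: the body
  frame derivative precomposed with \<open>Ad\<close> of the inverse turns left translation by \<open>x\<close> into right translation. Restricted to
  the subgroup this function is constant, so its differential is \<open>0\<close>.\<close>

lemma invariant_differential_vanishes:
  assumes G: "lie_group G M" and S: "lie_subgroup G M S"
    and P: "smooth_map M (vec_manifold :: (real, real) manifold) P" and x: "x \<in> carrier G"
    and invar: "\<And>h. h \<in> topspace (mtop S) \<Longrightarrow> P (h \<otimes>\<^bsub>G\<^esub> x) = P x"
  shows "coAd G M (inv\<^bsub>G\<^esub> x) (left_pullback G M x (tangent_map M vec_manifold P x))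
           o\<^sub>L tangent_map S M (\<lambda>y. y) \<one>\<^bsub>G\<^esub> = 0"
proof -
  interpret group G using G by (simp add: lie_group_def)
  have M: "smooth_manifold M" and top: "topspace (mtop M) = carrier G"
    using G by (auto simp: lie_group_def)
  have SM: "smooth_manifold S" and incl: "smooth_map S M (\<lambda>y. y)"
    and sub: "subgroup (topspace (mtop S)) G"
    using S by (auto simp: lie_subgroup_def lie_group_def)
  have oneS: "\<one>\<^bsub>G\<^esub> \<in> topspace (mtop S)" using subgroup.one_closed[OF sub] .
  have ix: "inv\<^bsub>G\<^esub> x \<in> carrier G" using x by simp
  have one: "inv\<^bsub>G\<^esub> x \<otimes>\<^bsub>G\<^esub> \<one>\<^bsub>G\<^esub> \<otimes>\<^bsub>G\<^esub> inv\<^bsub>G\<^esub> (inv\<^bsub>G\<^esub> x) = \<one>\<^bsub>G\<^esub>" using x by simp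
  note L = lie_group_differentiable_mult(1)[OF G x] and R = lie_group_differentiable_mult(2)[OF G x]
  note c = lie_group_differentiable_conj[OF G ix one_closed]
  note Lc = tangent_map_compose[OF M M c L, unfolded one, OF one_closed]
  have "tangent_map M M (\<lambda>y. x \<otimes>\<^bsub>G\<^esub> y) \<one>\<^bsub>G\<^esub> o\<^sub>L Ad G M (inv\<^bsub>G\<^esub> x)
      = tangent_map M M (\<lambda>y. x \<otimes>\<^bsub>G\<^esub> (inv\<^bsub>G\<^esub> x \<otimes>\<^bsub>G\<^esub> y \<otimes>\<^bsub>G\<^esub> inv\<^bsub>G\<^esub> (inv\<^bsub>G\<^esub> x))) \<one>\<^bsub>G\<^esub>"
    using Lc(1) by (simp add: Ad_def)
  also have "\<dots> = tangent_map M M (\<lambda>y. y \<otimes>\<^bsub>G\<^esub> x) \<one>\<^bsub>G\<^esub>"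
    by (rule tangent_map_cong[OF M _ _ Lc(2)])
      (use x top in \<open>auto simp: m_assoc[symmetric]\<close>)
  finally have LAd: "tangent_map M M (\<lambda>y. x \<otimes>\<^bsub>G\<^esub> y) \<one>\<^bsub>G\<^esub> o\<^sub>L Ad G M (inv\<^bsub>G\<^esub> x)
      = tangent_map M M (\<lambda>y. y \<otimes>\<^bsub>G\<^esub> x) \<one>\<^bsub>G\<^esub>" .
  have dP: "differentiable_map_at M vec_manifold P (\<one>\<^bsub>G\<^esub> \<otimes>\<^bsub>G\<^esub> x)"
    by (rule smooth_map_imp_differentiable_map_at[OF M smooth_manifold_vec P]) (use x top in simp)
  have dI: "differentiable_map_at S M (\<lambda>y. y) \<one>\<^bsub>G\<^esub>"
    by (rule smooth_map_imp_differentiable_map_at[OF SM M incl oneS])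
  note PR = tangent_map_compose[OF M M R[OF one_closed] dP]
  note PRI = tangent_map_compose[OF SM M dI PR(2)]
  have "tangent_map S vec_manifold (\<lambda>h. P (h \<otimes>\<^bsub>G\<^esub> x)) \<one>\<^bsub>G\<^esub> = 0"
    by (rule tangent_map_const[OF SM oneS invar PRI(2)])
  then have "tangent_map M vec_manifold P x o\<^sub>L tangent_map M M (\<lambda>y. y \<otimes>\<^bsub>G\<^esub> x) \<one>\<^bsub>G\<^esub>
      o\<^sub>L tangent_map S M (\<lambda>y. y) \<one>\<^bsub>G\<^esub> = 0"
    using PRI(1) PR(1) x by simp
  then show ?thesis
    by (simp add: coAd_def left_pullback_def blinfun_compose_assoc LAd[symmetric])
qed

section \<open>Momentum relations on triangles and at vertices\<close>

lemma i_star_linear: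
  "i_star T (\<alpha> + \<beta>) = i_star T \<alpha> + i_star T \<beta>"
  "i_star T (\<alpha> - \<beta>) = i_star T \<alpha> - i_star T \<beta>"
  "i_star T (- \<alpha>) = - i_star T \<alpha>"
  "i_star T (c *\<^sub>R \<alpha>) = c *\<^sub>R i_star T \<alpha>"
  "i_star T 0 = 0"
  by (auto intro!: blinfun_eqI simp: i_star_def blinfun.bilinear_simps)

lemma tau_xi_eta:
  assumes "field_theory T" "discrete_field T N A g" "j < N" "a < A"
  shows "tau T (dt T *\<^sub>R xi T g j a) = inv\<^bsub>grp T\<^esub> (g j a) \<otimes>\<^bsub>grp T\<^esub> g (j + 1) a"
    and "tau T (ds T *\<^sub>R eta T g j a) = inv\<^bsub>grp T\<^esub> (g j a) \<otimes>\<^bsub>grp T\<^esub> g j (a + 1)"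
proof -
  have "dt T > 0" "ds T > 0" using assms(1) by (auto simp: field_theory_def)
  moreover have "inv\<^bsub>grp T\<^esub> (g j a) \<otimes>\<^bsub>grp T\<^esub> g (j + 1) a \<in> tau T ` tau_dom T"
    "inv\<^bsub>grp T\<^esub> (g j a) \<otimes>\<^bsub>grp T\<^esub> g j (a + 1) \<in> tau T ` tau_dom T"
    using assms by (auto simp: discrete_field_def)
  ultimately show "tau T (dt T *\<^sub>R xi T g j a) = inv\<^bsub>grp T\<^esub> (g j a) \<otimes>\<^bsub>grp T\<^esub> g (j + 1) a"
    "tau T (ds T *\<^sub>R eta T g j a) = inv\<^bsub>grp T\<^esub> (g j a) \<otimes>\<^bsub>grp T\<^esub> g j (a + 1)"
    unfolding xi_def eta_def by (auto simp: f_inv_into_f)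
qed

text \<open>All three momentum maps of a triangle can be expressed in the spatial frame at its base vertex, since the
  other two vertices are reached by the increments \<open>\<tau>(\<Delta>t \<xi>)\<close> and \<open>\<tau>(\<Delta>s \<eta>)\<close>.\<close>

lemma momentum_maps_base_point:
  assumes T: "field_theory T" and g: "discrete_field T N A g" and "j < N" "a < A"
  shows "J2 T g j a = ds T *\<^sub>R i_star T (Ad_star T (inv\<^bsub>grp T\<^esub> (g j a)) (mu T g j a))"
    and "J3 T g j a = - (dt T *\<^sub>R i_star T (Ad_star T (inv\<^bsub>grp T\<^esub> (g j a)) (lam T g j a)))"
proof -
  have G: "lie_group (grp T) (mfd T)" using T by (simp add: field_theory_def)
  interpret group "grp T" using G by (simp add: lie_group_def)
  have c: "g j a \<in> carrier (grp T)" "g (j + 1) a \<in> carrier (grp T)" "g j (a + 1) \<in> carrier (grp T)"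
    using g assms(3,4) by (auto simp: discrete_field_def)
  have m: "x \<otimes>\<^bsub>grp T\<^esub> (inv\<^bsub>grp T\<^esub> x \<otimes>\<^bsub>grp T\<^esub> y) = y"
    if "x \<in> carrier (grp T)" "y \<in> carrier (grp T)" for x y
    using that by (simp add: m_assoc[symmetric])
  note step = coAd_inv_mult[OF G c(1), of "inv\<^bsub>grp T\<^esub> (g j a) \<otimes>\<^bsub>grp T\<^esub> y" for y]
  note t = tau_xi_eta[OF assms]
  show "J2 T g j a = ds T *\<^sub>R i_star T (Ad_star T (inv\<^bsub>grp T\<^esub> (g j a)) (mu T g j a))"
    using step[of "g (j + 1) a"] c
    by (simp add: J2_def Ad_star_mu_def t(1)[simplified] coAd_linear i_star_linear m)
  show "J3 T g j a = - (dt T *\<^sub>R i_star T (Ad_star T (inv\<^bsub>grp T\<^esub> (g j a)) (lam T g j a)))"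
    using step[of "g j (a + 1)"] c
    by (simp add: J3_def Ad_star_lam_def t(2)[simplified] coAd_linear i_star_linear m)
qed

text \<open>The local Noether identity. At the base vertex the \<open>\<mu>\<close> and \<open>\<lambda>\<close> contributions cancel
  identically, and the remaining potential term is killed by \<open>H\<close>-invariance.
  This is a property of the density alone, so it also holds on triangles at the boundary.\<close>

lemma triangle_Noether:
  assumes S: "noether_setting T N A g" and j: "j < N" and a: "a < A"
  shows "J1 T g j a + J2 T g j a + J3 T g j a = 0"
proof -
  have T: "field_theory T" and g: "discrete_field T N A g" and H: "H_invariant T N A"
    using S by (auto simp: noether_setting_def)
  have x: "g j a \<in> carrier (grp T)" using g j a by (auto simp: discrete_field_def)
  have pos: "dt T > 0" "ds T > 0" using T by (auto simp: field_theory_def)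
  have "Pot T (h \<otimes>\<^bsub>grp T\<^esub> g j a) = Pot T (g j a)" if "h \<in> topspace (mtop (sgrp T))" for h
  proof -
    \<comment> \<open>The kinetic and elastic parts are the same on both sides, so any arguments \<open>\<xi>\<close>, \<open>\<eta>\<close> will do.\<close>
    have "Lagr T (tri j a) (h \<otimes>\<^bsub>grp T\<^esub> g j a) 0 0 = Lagr T (tri j a) (g j a) 0 0"
      using H j a that x by (simp add: H_invariant_def)
    then show ?thesis using pos by (simp add: Lagr_def)
  qed
  then have "i_star T (Ad_star T (inv\<^bsub>grp T\<^esub> (g j a)) (force T g j a)) = 0"
    unfolding i_star_def force_def
    using T x by (intro invariant_differential_vanishes) (auto simp: field_theory_def)
  then show ?thesis
    by (simp add: momentum_maps_base_point[OF T g j a] J1_def coAd_linear i_star_linear)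
qed

text \<open>The momentum maps that share a vertex \<open>(j, a)\<close>, coming from the up to three triangles that contain it, add up to
  the left-hand side of the field equation there, scaled by \<open>\<Delta>t \<Delta>s\<close>, taken to the spatial frame and restricted to the
  Lie algebra of the subgroup. The second and third identities drop the triangle on the side
  \<open>a - 1\<close> or \<open>j - 1\<close>; they turn the zero-traction and zero-momentum conditions into statements about momentum maps.\<close>

lemma J1_J2_J3_at_vertex:
  assumes "field_theory T"
  shows "J1 T g (Suc j) (Suc a) + J2 T g j (Suc a) + J3 T g (Suc j) a =
      (dt T * ds T) *\<^sub>R i_star T (Ad_star T (inv\<^bsub>grp T\<^esub> (g (Suc j) (Suc a)))
        ((- mu T g (Suc j) (Suc a) + Ad_star_mu T g j (Suc a)) /\<^sub>R dt T
         + (lam T g (Suc j) (Suc a) - Ad_star_lam T g (Suc j) a) /\<^sub>R ds T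
         - force T g (Suc j) (Suc a)))"
    and "J1 T g (Suc j) a + J2 T g j a =
      (dt T * ds T) *\<^sub>R i_star T (Ad_star T (inv\<^bsub>grp T\<^esub> (g (Suc j) a))
        ((- mu T g (Suc j) a + Ad_star_mu T g j a) /\<^sub>R dt T
         + lam T g (Suc j) a /\<^sub>R ds T - force T g (Suc j) a))"
    and "J1 T g j (Suc a) + J3 T g j a =
      (dt T * ds T) *\<^sub>R i_star T (Ad_star T (inv\<^bsub>grp T\<^esub> (g j (Suc a)))
        (- (mu T g j (Suc a) /\<^sub>R dt T)
         + (lam T g j (Suc a) - Ad_star_lam T g j a) /\<^sub>R ds T - force T g j (Suc a)))"
proof -
  have "dt T > 0" "ds T > 0" using assms by (auto simp: field_theory_def)
  then have [simp]: "ds T * (dt T * inverse (ds T)) = dt T" "ds T * (dt T * inverse (dt T)) = ds T"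
    by (auto simp: field_simps)
  show "J1 T g (Suc j) (Suc a) + J2 T g j (Suc a) + J3 T g (Suc j) a =
      (dt T * ds T) *\<^sub>R i_star T (Ad_star T (inv\<^bsub>grp T\<^esub> (g (Suc j) (Suc a)))
        ((- mu T g (Suc j) (Suc a) + Ad_star_mu T g j (Suc a)) /\<^sub>R dt T
         + (lam T g (Suc j) (Suc a) - Ad_star_lam T g (Suc j) a) /\<^sub>R ds T
         - force T g (Suc j) (Suc a)))"
    and "J1 T g (Suc j) a + J2 T g j a =
      (dt T * ds T) *\<^sub>R i_star T (Ad_star T (inv\<^bsub>grp T\<^esub> (g (Suc j) a))
        ((- mu T g (Suc j) a + Ad_star_mu T g j a) /\<^sub>R dt T
         + lam T g (Suc j) a /\<^sub>R ds T - force T g (Suc j) a))"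
    and "J1 T g j (Suc a) + J3 T g j a =
      (dt T * ds T) *\<^sub>R i_star T (Ad_star T (inv\<^bsub>grp T\<^esub> (g j (Suc a)))
        (- (mu T g j (Suc a) /\<^sub>R dt T)
         + (lam T g j (Suc a) - Ad_star_lam T g j a) /\<^sub>R ds T - force T g j (Suc a)))"
    by (simp_all add: J1_def J2_def J3_def coAd_linear i_star_linear algebra_simps)
qed

lemma vertex_sum:
  assumes S: "noether_setting T N A g" and j: "j \<in> {1..<N}" and a: "a \<in> {1..<A}"
  shows "J1 T g j a + J2 T g (j - 1) a + J3 T g j (a - 1) = 0"
proof -
  obtain j' a' where [simp]: "j = Suc j'" "a = Suc a'"
    using j a by (metis atLeastLessThan_iff not0_implies_Suc not_one_le_zero)
  have T: "field_theory T" and "DCEL T g N A" using S by (auto simp: noether_setting_def)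
  then have "(- mu T g j a + Ad_star_mu T g (j - 1) a) /\<^sub>R dt T
      + (lam T g j a - Ad_star_lam T g j (a - 1)) /\<^sub>R ds T - force T g j a = 0"
    using j a unfolding DCEL_def by blast
  then show ?thesis
    using J1_J2_J3_at_vertex(1)[OF T, of g j' a'] by (simp add: coAd_linear(5) i_star_linear(5))
qed

section \<open>Regrouping sums over triangles by vertices\<close>

text \<open>Regrouping a row of cells by vertices: \<open>p\<close> is collected at the left end of each cell and \<open>q\<close>
  at the right end, so each interior vertex receives one of each.\<close>

lemma sum_shift_row:
  fixes p q :: "nat \<Rightarrow> 'v::ab_group_add"
  assumes "B \<le> C"
  shows "(\<Sum>a=B..C. p a + q a) = p B + (\<Sum>a=B+1..C. p a + q (a - 1)) + q C"
  using assms
proof (induction C rule: dec_induct)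
  case (step n)
  then show ?case by (simp add: algebra_simps)
qed simp

text \<open>A discrete Stokes formula. Summing all three contributions over the triangles of a rectangle and regrouping by
  vertices, those of the vertices with \<open>j > K\<close> and \<open>a > B\<close> that are collected completely form the second sum on the right;
  the left-hand side is what remains along the boundary.\<close>

lemma boundary_sum:
  fixes u1 u2 u3 :: "nat \<Rightarrow> nat \<Rightarrow> 'v::ab_group_add"
  assumes "B \<le> C" "K \<le> L"
  shows "(\<Sum>j=K+1..L. u1 j B + u2 (j - 1) B + u3 j C)
      + (\<Sum>a=B+1..C. u1 K a + u2 L a + u3 K (a - 1)) + u1 K B + u2 L B + u3 K C
    = (\<Sum>j=K..L. \<Sum>a=B..C. u1 j a + u2 j a + u3 j a)
      - (\<Sum>j=K+1..L. \<Sum>a=B+1..C. u1 j a + u2 (j - 1) a + u3 j (a - 1))"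
    (is "?l L = ?r L")
  using assms(2)
proof (induction L rule: dec_induct)
  case base
  then show ?case
    using sum_shift_row[OF assms(1), of "\<lambda>a. u1 K a + u2 K a" "\<lambda>a. u3 K a"]
    by (simp add: algebra_simps)
next
  case (step n)
  let ?D = "(\<Sum>a=B+1..C. u2 (Suc n) a) - (\<Sum>a=B+1..C. u2 n a)"
  let ?d = "u1 (Suc n) B + u2 (Suc n) B + u3 (Suc n) C + ?D"
  have tail: "sum f {K+1..Suc n} = sum f {K+1..n} + f (Suc n)"
    "sum f {K..Suc n} = sum f {K..n} + f (Suc n)" for f :: "nat \<Rightarrow> 'v"
    using step by auto
  have swap: "(\<Sum>a=B+1..C. x a + u2 (Suc n) a + y a) = (\<Sum>a=B+1..C. x a + u2 n a + y a) + ?D"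
    for x y by (simp add: sum.distrib)
  have row: "(\<Sum>a=B..C. u1 (Suc n) a + u2 (Suc n) a + u3 (Suc n) a)
      = (\<Sum>a=B+1..C. u1 (Suc n) a + u2 n a + u3 (Suc n) (a - 1)) + ?d"
    using sum_shift_row[OF assms(1), of "\<lambda>a. u1 (Suc n) a + u2 (Suc n) a" "\<lambda>a. u3 (Suc n) a"]
    by (simp only: swap) (simp only: ac_simps)
  have "?l (Suc n) = ?l n + ?d"
    by (simp only: tail swap diff_Suc_1) (simp add: algebra_simps)
  moreover have "?r (Suc n) = ?r n + ?d"
    by (simp only: tail row diff_Suc_1) (simp add: algebra_simps)
  ultimately show ?case by (simp only: step.IH)
qed

section \<open>Noether theorems\<close>

lemma discrete_covariant_Noether:
  assumes S: "noether_setting T N A g" and "B < C" "C \<le> A - 1" "K < L" "L \<le> N - 1"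
  shows "Noether_sum T g B C K L = 0"
proof -
  have "(\<Sum>j=K..L. \<Sum>a=B..C. J1 T g j a + J2 T g j a + J3 T g j a) = 0"
    using assms by (intro sum.neutral ballI triangle_Noether[OF S]) auto
  moreover have "(\<Sum>j=K+1..L. \<Sum>a=B+1..C. J1 T g j a + J2 T g (j - 1) a + J3 T g j (a - 1)) = 0"
    using assms by (intro sum.neutral ballI vertex_sum[OF S]) auto
  ultimately show ?thesis
    using boundary_sum[of B C K L "J1 T g" "J2 T g" "J3 T g"] assms
    by (simp add: Noether_sum_def)
qed

lemma JL_plus_eq_minus:
  assumes "noether_setting T N A g" "j < N"
  shows "JL_plus T g A j = JL_minus T g A j"
proof -
  have "JL_plus T g A j - JL_minus T g A j = (\<Sum>a<A. J1 T g j a + J2 T g j a + J3 T g j a)"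
    by (simp add: JL_plus_def JL_minus_def sum.distrib)
  also have "\<dots> = 0" using triangle_Noether[OF assms] by (simp add: sum.neutral)
  finally show ?thesis by simp
qed

lemma JN_plus_eq_minus:
  assumes "noether_setting T N A g" "a < A"
  shows "JN_plus T g N a = JN_minus T g N a"
proof -
  have "JN_plus T g N a - JN_minus T g N a = (\<Sum>j<N. J1 T g j a + J2 T g j a + J3 T g j a)"
    by (simp add: JN_plus_def JN_minus_def sum.distrib)
  also have "\<dots> = 0" using triangle_Noether[OF assms(1) _ assms(2)] by (simp add: sum.neutral)
  finally show ?thesis by simp
qed

lemma conserved_cong:
  assumes "\<And>k. k < n \<Longrightarrow> J k = J' k"
  shows "conserved n J \<longleftrightarrow> conserved n J'"
  using assms unfolding conserved_def by metis

lemma conservedI: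
  assumes "\<And>k. Suc k < n \<Longrightarrow> J (Suc k) = J k"
  shows "conserved n J"
proof -
  have "J k = J 0" if "k < n" for k
    using that
  proof (induction k)
    case (Suc k)
    then show ?case using assms[of k] by simp
  qed simp
  then show ?thesis unfolding conserved_def by metis
qed

text \<open>The momentum leaving time level \<open>j - 1\<close> minus the momentum entering time level \<open>j\<close>, regrouped by
  vertices of level \<open>j\<close>, consists of field equations at interior vertices and one term at each spatial end; the two parts
  of the zero-traction condition make these end terms vanish.\<close>

lemma zero_traction_conserves_JL:
  assumes S: "noether_setting T N A g" and Z: "zero_traction T g N A"
  shows "conserved N (JL_plus T g A)"
proof (rule conservedI)
  fix k assume k: "Suc k < N"
  let ?j = "Suc k"
  have T: "field_theory T" and A: "1 \<le> A" using S by (auto simp: noether_setting_def)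
  have A': "{..<A} = {0..A - 1}" using A by auto
  have z: "(- mu T g ?j 0 + Ad_star_mu T g k 0) /\<^sub>R dt T + lam T g ?j 0 /\<^sub>R ds T = force T g ?j 0"
    "Ad_star_lam T g ?j (A - 1) = 0"
    using Z k unfolding zero_traction_def by (metis One_nat_def atLeastLessThan_iff diff_Suc_1 le_add1 plus_1_eq_Suc)+
  have left: "J1 T g ?j 0 + J2 T g k 0 = 0"
    by (simp only: J1_J2_J3_at_vertex(2)[OF T] z(1) diff_self coAd_linear(5) i_star_linear(5) scaleR_zero_right)
  have right: "J3 T g ?j (A - 1) = 0"
    unfolding J3_def z(2) by (simp add: coAd_linear i_star_linear)
  have "JL_plus T g A k - JL_minus T g A ?j
      = (\<Sum>a=0..A - 1. (J1 T g ?j a + J2 T g k a) + J3 T g ?j a)"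
    by (simp add: JL_plus_def JL_minus_def sum.distrib A')
  also have "\<dots> = (\<Sum>a=1..A - 1. J1 T g ?j a + J2 T g k a + J3 T g ?j (a - 1))"
    using sum_shift_row[of 0 "A - 1" "\<lambda>a. J1 T g ?j a + J2 T g k a" "\<lambda>a. J3 T g ?j a"] left right
    by simp
  also have "\<dots> = 0"
    using vertex_sum[OF S, of ?j] k by (intro sum.neutral) auto
  finally show "JL_plus T g A ?j = JL_plus T g A k"
    using JL_plus_eq_minus[OF S k] by simp
qed

text \<open>The same argument with the roles of time and space, and of \<open>J2\<close> and \<open>J3\<close>, exchanged.\<close>

lemma zero_momentum_conserves_JN:
  assumes S: "noether_setting T N A g" and Z: "zero_momentum T g N A"
  shows "conserved A (JN_plus T g N)"
proof (rule conservedI)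
  fix k assume k: "Suc k < A"
  let ?a = "Suc k"
  have T: "field_theory T" and N: "1 \<le> N" using S by (auto simp: noether_setting_def)
  have N': "{..<N} = {0..N - 1}" using N by auto
  have z: "- (mu T g 0 ?a /\<^sub>R dt T) + (lam T g 0 ?a - Ad_star_lam T g 0 k) /\<^sub>R ds T = force T g 0 ?a"
    "Ad_star_mu T g (N - 1) ?a = 0"
    using Z k unfolding zero_momentum_def by (metis One_nat_def atLeastLessThan_iff diff_Suc_1 le_add1 plus_1_eq_Suc)+
  have left: "J1 T g 0 ?a + J3 T g 0 k = 0"
    by (simp only: J1_J2_J3_at_vertex(3)[OF T] z(1) diff_self coAd_linear(5) i_star_linear(5) scaleR_zero_right)
  have right: "J2 T g (N - 1) ?a = 0"
    unfolding J2_def z(2) by (simp add: coAd_linear i_star_linear)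
  have "JN_plus T g N k - JN_minus T g N ?a
      = (\<Sum>j=0..N - 1. (J1 T g j ?a + J3 T g j k) + J2 T g j ?a)"
    by (simp add: JN_plus_def JN_minus_def sum.distrib N')
  also have "\<dots> = (\<Sum>j=1..N - 1. J1 T g j ?a + J3 T g j k + J2 T g (j - 1) ?a)"
    using sum_shift_row[of 0 "N - 1" "\<lambda>j. J1 T g j ?a + J3 T g j k" "\<lambda>j. J2 T g j ?a"] left right
    by simp
  also have "\<dots> = (\<Sum>j=1..N - 1. J1 T g j ?a + J2 T g (j - 1) ?a + J3 T g j (?a - 1))"
    by (simp add: algebra_simps)
  also have "\<dots> = 0"
    using vertex_sum[OF S, of _ ?a] k by (intro sum.neutral) auto
  finally show "JN_plus T g N ?a = JN_plus T g N k"
    using JN_plus_eq_minus[OF S k] by simp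
qed

section \<open>The discrete wave equation on the line\<close>

definition line_group :: "real monoid" where
  "line_group = \<lparr>carrier = UNIV, mult = (+), one = 0\<rparr>"

text \<open>With these data the discrete covariant Euler-Lagrange equations are the standard discretization of the linear wave
  equation, and the additive line acts on itself by translations.\<close>

definition wave_theory :: "(real, real, real) field_theory" where
  "wave_theory = \<lparr>grp = line_group, mfd = vec_manifold, sgrp = vec_manifold, dt = 1, ds = 1,
     Kin = (\<lambda>x. x\<^sup>2 / 2), Ela = (\<lambda>x. x\<^sup>2 / 2), Pot = (\<lambda>_. 0), tau = (\<lambda>x. x), tau_dom = UNIV\<rparr>"

lemma line_group_simps [simp]:
  "carrier line_group = UNIV" "x \<otimes>\<^bsub>line_group\<^esub> y = x + y" "\<one>\<^bsub>line_group\<^esub> = 0"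
  "line_group\<lparr>carrier := UNIV\<rparr> = line_group"
  by (simp_all add: line_group_def)

lemma group_line_group: "group line_group"
  by (rule groupI) (auto intro: exI[of _ "- x" for x])

lemma inv_line_group [simp]: "inv\<^bsub>line_group\<^esub> x = - x"
  by (rule group.inv_equality[OF group_line_group]) auto

lemma wave_theory_simps [simp]:
  "grp wave_theory = line_group" "mfd wave_theory = vec_manifold" "sgrp wave_theory = vec_manifold"
  "dt wave_theory = 1" "ds wave_theory = 1"
  "Kin wave_theory = (\<lambda>x. x\<^sup>2 / 2)" "Ela wave_theory = (\<lambda>x. x\<^sup>2 / 2)"
  "Pot wave_theory = (\<lambda>_. 0)" "tau wave_theory = (\<lambda>x. x)" "tau_dom wave_theory = UNIV"
  by (simp_all add: wave_theory_def)

lemma half_square_has_derivative: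
  "((\<lambda>x::real. x\<^sup>2 / 2) has_derivative (\<lambda>v. x * v)) (at x)"
  by (auto intro!: derivative_eq_intros simp: power2_eq_square)

lemma tangent_map_half_square:
  "tangent_map vec_manifold vec_manifold (\<lambda>x::real. x\<^sup>2 / 2) p = p *\<^sub>R id_blinfun"
proof -
  have "Blinfun (\<lambda>v. p * v) = p *\<^sub>R id_blinfun"
    by (rule blinfun_eqI) (simp add: bounded_linear_Blinfun_apply bounded_linear_mult_right scaleR_blinfun.rep_eq)
  then show ?thesis
    by (simp add: tangent_map_vec frechet_derivative_eqI[OF half_square_has_derivative])
qed

lemma lie_group_line_group: "lie_group line_group vec_manifold"
proof -
  have "smooth_on UNIV (\<lambda>(x, y). x + y :: real)"
    by (rule smooth_on_bounded_linear)
      (simp add: split_def bounded_linear_add bounded_linear_fst bounded_linear_snd)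
  moreover have "inv_into UNIV (map_prod (\<lambda>x::real. x) (\<lambda>x::real. x)) = (\<lambda>x. x)"
    by (simp add: map_prod.identity[unfolded id_def])
  moreover have "continuous_on UNIV (\<lambda>(x, y). x + y :: real)"
    by (simp add: split_def continuous_intros)
  ultimately have "smooth_map (prod_manifold vec_manifold vec_manifold) vec_manifold
      (\<lambda>(x, y). x + y :: real)"
    by (simp add: smooth_map_def prod_manifold_def o_def)
  moreover have "smooth_map vec_manifold vec_manifold (\<lambda>x::real. - x)"
    by (simp add: smooth_map_vec smooth_on_bounded_linear bounded_linear_minus bounded_linear_ident
        continuous_intros)
  moreover have "m_inv line_group = uminus" by (rule ext) simp
  ultimately show ?thesis
    by (simp add: lie_group_def group_line_group smooth_manifold_vec)
qed

lemma field_theory_wave: "field_theory wave_theory"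
proof -
  have id: "smooth_map vec_manifold vec_manifold (\<lambda>x::real. x)"
    by (simp add: smooth_map_vec smooth_on_bounded_linear bounded_linear_ident)
  moreover have "lie_subgroup line_group vec_manifold (vec_manifold :: (real, real) manifold)"
    using lie_group_line_group id group.subgroup_self[OF group_line_group]
    by (simp add: lie_subgroup_def tangent_map_vec_translation[of _ 0] id_blinfun.rep_eq)
  moreover have "smooth_on UNIV (\<lambda>x::real. x\<^sup>2 / 2)"
    by (rule smooth_onI_derivative[OF half_square_has_derivative])
      (rule smooth_on_bounded_linear, rule bounded_linear_mult_left)
  then have "smooth_map vec_manifold vec_manifold (\<lambda>x::real. x\<^sup>2 / 2)"
    by (simp add: smooth_map_vec continuous_intros)
  moreover have "smooth_map vec_manifold vec_manifold (\<lambda>x::real. 0::real)"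
    by (simp add: smooth_map_vec smooth_on_const)
  ultimately show ?thesis
    using lie_group_line_group by (simp add: field_theory_def open_submanifold_UNIV)
qed

lemma compose_id_blinfun: "\<beta> o\<^sub>L id_blinfun = \<beta>"
  by (rule blinfun_eqI) simp

lemma coAd_line_group: "coAd line_group vec_manifold x \<alpha> = \<alpha>"
  by (simp add: coAd_def Ad_def tangent_map_vec_translation[of _ 0] compose_id_blinfun)

text \<open>The group is commutative, so all transports are trivial and the momenta are multiples of \<^const>\<open>id_blinfun\<close>
  by difference quotients of the field.\<close>

lemma wave_momenta:
  "xi wave_theory g j a = g (Suc j) a - g j a"
  "eta wave_theory g j a = g j (Suc a) - g j a"
  "mu wave_theory g j a = (g (Suc j) a - g j a) *\<^sub>R id_blinfun"
  "lam wave_theory g j a = (g j (Suc a) - g j a) *\<^sub>R id_blinfun"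
  "Ad_star_mu wave_theory g j a = mu wave_theory g j a"
  "Ad_star_lam wave_theory g j a = lam wave_theory g j a"
  "force wave_theory g j a = 0"
  "J2 wave_theory g j a = mu wave_theory g j a"
  "J3 wave_theory g j a = - lam wave_theory g j a"
proof -
  show xi: "xi wave_theory g j a = g (Suc j) a - g j a"
    and eta: "eta wave_theory g j a = g j (Suc a) - g j a"
    by (simp_all add: xi_def eta_def)
  have "right_triv_deriv line_group vec_manifold (\<lambda>x. x) \<xi> = id_blinfun" for \<xi>
    by (simp add: right_triv_deriv_def tangent_map_vec_translation[of _ 0]
        tangent_map_vec_translation[of _ "- \<xi>"] compose_id_blinfun)
  then have r: "right_triv_deriv_inv line_group vec_manifold (\<lambda>x. x) \<xi> = id_blinfun" for \<xi>
    by (simp add: right_triv_deriv_inv_def id_blinfun.rep_eq Blinfun_ident)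
  show "mu wave_theory g j a = (g (Suc j) a - g j a) *\<^sub>R id_blinfun"
    by (simp add: mu_def r tangent_map_half_square xi compose_id_blinfun)
  show "lam wave_theory g j a = (g j (Suc a) - g j a) *\<^sub>R id_blinfun"
    by (simp add: lam_def r tangent_map_half_square eta compose_id_blinfun)
  have "i_star wave_theory \<alpha> = \<alpha>" for \<alpha>
    by (simp add: i_star_def tangent_map_vec_translation[of _ 0] compose_id_blinfun)
  then show "Ad_star_mu wave_theory g j a = mu wave_theory g j a"
    "Ad_star_lam wave_theory g j a = lam wave_theory g j a"
    "J2 wave_theory g j a = mu wave_theory g j a"
    "J3 wave_theory g j a = - lam wave_theory g j a"
    by (simp_all add: Ad_star_mu_def Ad_star_lam_def J2_def J3_def coAd_line_group)
  have "tangent_map vec_manifold vec_manifold (\<lambda>x::real. 0::real) p = 0" for p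
    by (simp add: tangent_map_vec zero_blinfun_def)
  then show "force wave_theory g j a = 0"
    by (simp add: force_def left_pullback_def)
qed

text \<open>A string at rest at \<open>0\<close> on its left end, with all other nodes moving at the velocity \<open>-1\<close>. It is flat at time
  \<open>1\<close>, the only time at which zero traction is imposed for \<open>N = 2\<close>. At time \<open>0\<close> only the segment next to the
  left end is stretched, so the spatial momentum differs between \<open>a = 0\<close> and \<open>a = 1\<close>.\<close>

definition wave_field :: "nat \<Rightarrow> nat \<Rightarrow> real" where
  "wave_field j a = (1 - real j) * (if a = 0 then 0 else 1)"

lemma atLeastLessThan_1_2: "{1..<2::nat} = {1}" by auto

lemma noether_setting_wave:
  assumes "g 2 1 - 2 * g 1 1 + g 0 1 = g 1 2 - 2 * g 1 1 + g 1 0"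
  shows "noether_setting wave_theory 2 2 g"
proof -
  have "DCEL wave_theory g 2 2"
    using assms
    by (simp add: DCEL_def atLeastLessThan_1_2 wave_momenta numeral_2_eq_2 flip: scaleR_left.minus
        scaleR_add_left scaleR_diff_left)
  then show ?thesis
    by (simp add: noether_setting_def field_theory_wave H_invariant_def Lagr_def discrete_field_def)
qed

lemma wave_JN_not_conserved:
  "noether_setting wave_theory 2 2 wave_field" "zero_traction wave_theory wave_field 2 2"
    "\<not> conserved 2 (JN_plus wave_theory wave_field 2)"
proof -
  show "noether_setting wave_theory 2 2 wave_field"
    by (rule noether_setting_wave) (simp add: wave_field_def)
  show "zero_traction wave_theory wave_field 2 2"
    by (simp add: zero_traction_def atLeastLessThan_1_2 wave_momenta wave_field_def)
  have "JN_plus wave_theory wave_field 2 0 = - id_blinfun"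
    "JN_plus wave_theory wave_field 2 1 = 0"
    by (simp_all add: JN_plus_def lessThan_Suc numeral_2_eq_2 wave_momenta wave_field_def)
  then have "JN_plus wave_theory wave_field 2 0 \<noteq> JN_plus wave_theory wave_field 2 1"
    by (metis id_blinfun.rep_eq neg_equal_0_iff_equal zero_blinfun.rep_eq zero_neq_one)
  then show "\<not> conserved 2 (JN_plus wave_theory wave_field 2)"
    unfolding conserved_def by (metis one_less_numeral_iff pos2 semiring_norm(76))
qed

text \<open>The wave equation is unchanged when time and space are exchanged, while zero traction becomes zero momentum.
  The transposed field therefore serves for the other set of boundary conditions.\<close>

lemma wave_JL_not_conserved:
  defines "h \<equiv> \<lambda>j a. wave_field a j"
  shows "noether_setting wave_theory 2 2 h" "zero_momentum wave_theory h 2 2"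
    "\<not> conserved 2 (JL_plus wave_theory h 2)"
proof -
  show "noether_setting wave_theory 2 2 h"
    by (rule noether_setting_wave) (simp add: wave_field_def h_def)
  show "zero_momentum wave_theory h 2 2"
    by (simp add: zero_momentum_def atLeastLessThan_1_2 wave_momenta wave_field_def h_def)
  have "JL_plus wave_theory h 2 0 = id_blinfun" "JL_plus wave_theory h 2 1 = 0"
    by (simp_all add: JL_plus_def lessThan_Suc numeral_2_eq_2 wave_momenta wave_field_def h_def)
  then have "JL_plus wave_theory h 2 0 \<noteq> JL_plus wave_theory h 2 1"
    by (metis id_blinfun.rep_eq zero_blinfun.rep_eq zero_neq_one)
  then show "\<not> conserved 2 (JL_plus wave_theory h 2)"
    unfolding conserved_def by (metis one_less_numeral_iff pos2 semiring_norm(76))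
qed

section \<open>The discrete Noether theorems and their failure\<close>

theorem theorem4p2:
  fixes T :: "('g, 'e::real_normed_vector, 'f::real_normed_vector) field_theory"
    and N A :: nat and g :: "nat \<Rightarrow> nat \<Rightarrow> 'g"
  assumes "noether_setting T N A g"
  shows
    \<comment> \<open>(1)\<close>
    "(\<forall>B C K L. B < C \<and> C \<le> A - 1 \<and> K < L \<and> L \<le> N - 1 \<longrightarrow> Noether_sum T g B C K L = 0)
     \<and>
     (\<forall>u v. prescribed_temporal N A u v g \<and> zero_traction T g N A \<longrightarrow>
        (\<forall>j<N. JL_plus T g A j = JL_minus T g A j) \<and> conserved N (JL_plus T g A))
     \<and>
     (\<exists>(T' :: (real, real, real) field_theory) N' A' g' u v.
        2 \<le> N' \<and> 2 \<le> A' \<and> noether_setting T' N' A' g' \<and>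
        prescribed_temporal N' A' u v g' \<and> zero_traction T' g' N' A' \<and>
        \<not> conserved A' (JN_plus T' g' N') \<and> \<not> conserved A' (JN_minus T' g' N'))
     \<and>
     (\<forall>u v. prescribed_spatial N A u v g \<and> zero_momentum T g N A \<longrightarrow>
        (\<forall>a<A. JN_plus T g N a = JN_minus T g N a) \<and> conserved A (JN_plus T g N))
     \<and>
     (\<exists>(T' :: (real, real, real) field_theory) N' A' g' u v.
        2 \<le> N' \<and> 2 \<le> A' \<and> noether_setting T' N' A' g' \<and>
        prescribed_spatial N' A' u v g' \<and> zero_momentum T' g' N' A' \<and>
        \<not> conserved N' (JL_plus T' g' A') \<and> \<not> conserved N' (JL_minus T' g' A'))"
    (is "?covariant \<and> ?JL \<and> ?JN_fails \<and> ?JN \<and> ?JL_fails")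
proof (intro conjI)
  show ?covariant
    using discrete_covariant_Noether[OF assms] by blast
  show ?JL
    using JL_plus_eq_minus[OF assms] zero_traction_conserves_JL[OF assms] by blast
  show ?JN
    using JN_plus_eq_minus[OF assms] zero_momentum_conserves_JN[OF assms] by blast
  note wN = wave_JN_not_conserved
  have pN: "prescribed_temporal 2 2 (wave_field 0) (wave_field 2) wave_field"
    by (simp add: prescribed_temporal_def)
  have mN: "\<not> conserved 2 (JN_minus wave_theory wave_field 2)"
    using wN(3) conserved_cong[of 2 "JN_plus wave_theory wave_field 2", OF JN_plus_eq_minus[OF wN(1)]]
    by simp
  show ?JN_fails
    by (rule exI[of _ wave_theory], rule exI[of _ 2], rule exI[of _ 2], rule exI[of _ wave_field],
        rule exI[of _ "wave_field 0"], rule exI[of _ "wave_field 2"])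
      (intro conjI order_refl wN pN mN)
  let ?h = "\<lambda>j a. wave_field a j"
  note wL = wave_JL_not_conserved
  have pL: "prescribed_spatial 2 2 (wave_field 0) (wave_field 2) ?h"
    by (simp add: prescribed_spatial_def)
  have mL: "\<not> conserved 2 (JL_minus wave_theory ?h 2)"
    using wL(3) conserved_cong[of 2 "JL_plus wave_theory ?h 2", OF JL_plus_eq_minus[OF wL(1)]]
    by simp
  show ?JL_fails
    by (rule exI[of _ wave_theory], rule exI[of _ 2], rule exI[of _ 2], rule exI[of _ ?h],
        rule exI[of _ "wave_field 0"], rule exI[of _ "wave_field 2"])
      (intro conjI order_refl wL pL mL)
qed

end
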